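(* Let $0<r<1$ and let $H$ be a real-valued $C^2$ solution of the Euler–Lagrange equation of the five-vertex model on an open set of the $(x,y)$-plane, with gradient $(s,t)=(H_x,H_y)$ in the interior of $\mathcal N^*$, and let $u=u(s,t)$ be the associated point of the upper half plane. Near any point where $(x,y)\mapsto u$ is locally invertible, use $u=R e^{i\phi}$ as a local coordinate, so that $x,y,H$ become functions of $u$. Then there are an analytic function $g(u)$ and a choice of antiderivative $$\mathcal F(u)=\int\frac{r^2g(u)}{(1-u)(u-r^2)}\,du$$ such that, with $k(u)=\operatorname{Im}g(u)/\operatorname{Im}u=\dfrac{\operatorname{Im}\bigl(\mathcal F'(u)(1-u)(u-r^2)\bigr)}{r^2\operatorname{Im}u}$, $$x=\frac{-1}{r^2\mathcal A(w)-R^2\mathcal A(z)}\left[\operatorname{Im}\Bigl(\tfrac1\pi\mathcal F(u)\Bigr)+\operatorname{Re}\left(-\frac{\mathcal F'(u)(1-u)(u-r^2)\,\theta}{\pi(1-r^2)}+\mathcal A(z)R^2k(u)\right)\right],$$ $$y=\frac{u\overline u}{r^2}\bigl(x-k(u)\bigr),$$ $$H=\frac1{1-r^2}\left(-\overline{g(u)}+(\overline u-r^2)x+r^2(\overline u^{-1}-1)y\right).$$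
   Context: $\arg$ is the principal argument; $\mathrm{Li}(z)=-\int_0^z\log(1-\zeta)\,d\zeta/\zeta$; $B(z)=\frac1\pi(\arg z\log|1-z|+\operatorname{Im}\mathrm{Li}(z))$; $\mathcal A(z)=\frac1\pi\bigl(-z\arg z-(1-z)\arg(1-z)\bigr)$. The interior of $\mathcal N^*$ is $\{(s,t): s>0,\ t>0,\ \frac{1-r^2}{r^2}st+s+t-1<0\}$. For $(s,t)$ in this interior there is a unique $u$ in the open upper half plane such that, with $\theta=\pi-\arg(u-1)+\arg(u-r^2)$, one has $s\theta=\pi-\arg(u-1)$, $t\theta=\arg(u-r^2)-\arg u$, $(1-s-t)\theta=\arg u$. Set $$w=\frac{1-\overline u}{1-r^2},\qquad z=\frac{1-r^2/\overline u}{1-r^2};$$ then $\theta=\arg\frac{w}{1-w}=-\arg\frac{z}{1-z}$, $s=\arg w/\arg\frac{w}{1-w}$, $t=\arg z/\arg\frac{z}{1-z}$. The surface tension $\sigma(s,t)$ of the five-vertex model with corner weight $r$ has gradient $\sigma_s=X:=-\log(1-r^2)-B(\overline z)$, $\sigma_t=Y:=-\log(1-r^2)-B(w)$. The Euler–Lagrange equation for the height function $H$ is $\operatorname{div}_{x,y}(\nabla\sigma(\nabla H))=0$, i.e. $X_x+Y_y=0$ with $(s,t)=(H_x,H_y)$. Limit shapes of the model satisfy this equation where their gradient is in the interior of $\mathcal N^*$. *)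

theory Defs
  imports "HOL-Complex_Analysis.Complex_Analysis"
begin

text \<open>Principal branch of the dilogarithm, integrated along the segment from 0; the segment avoids
  the cut \<open>{1..}\<close> for every non-real endpoint, and only such endpoints occur below.\<close>

definition dilog :: "complex \<Rightarrow> complex" where
  "dilog z = - contour_integral (linepath 0 z) (\<lambda>\<zeta>. Ln (1 - \<zeta>) / \<zeta>)"

definition fun_B :: "complex \<Rightarrow> real" where
  "fun_B z = (1 / pi) * (Arg z * ln (cmod (1 - z)) + Im (dilog z))"

definition fun_A :: "complex \<Rightarrow> complex" where
  "fun_A z = (1 / of_real pi) * (- z * of_real (Arg z) - (1 - z) * of_real (Arg (1 - z)))"

definition interior_Nstar :: "real \<Rightarrow> (real \<times> real) set" where
  "interior_Nstar r = {(s, t). s > 0 \<and> t > 0 \<and> (1 - r\<^sup>2) / r\<^sup>2 * s * t + s + t - 1 < 0}"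

definition theta :: "real \<Rightarrow> complex \<Rightarrow> real" where
  "theta r u = pi - Arg (u - 1) + Arg (u - r\<^sup>2)"

definition u_point :: "real \<Rightarrow> real \<times> real \<Rightarrow> complex" where
  "u_point r = (\<lambda>(s, t). THE u. Im u > 0 \<and>
      s * theta r u = pi - Arg (u - 1) \<and>
      t * theta r u = Arg (u - r\<^sup>2) - Arg u \<and>
      (1 - s - t) * theta r u = Arg u)"

definition w_of :: "real \<Rightarrow> complex \<Rightarrow> complex" where
  "w_of r u = (1 - cnj u) / (1 - r\<^sup>2)"

definition z_of :: "real \<Rightarrow> complex \<Rightarrow> complex" where
  "z_of r u = (1 - r\<^sup>2 / cnj u) / (1 - r\<^sup>2)"

text \<open>\<open>(sigma_s, sigma_t)\<close> is the gradient of the surface tension, as a function of the slope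
  \<open>(s, t)\<close>.\<close>

definition sigma_s :: "real \<Rightarrow> real \<times> real \<Rightarrow> real" where
  "sigma_s r st = - ln (1 - r\<^sup>2) - fun_B (cnj (z_of r (u_point r st)))"

definition sigma_t :: "real \<Rightarrow> real \<times> real \<Rightarrow> real" where
  "sigma_t r st = - ln (1 - r\<^sup>2) - fun_B (w_of r (u_point r st))"

definition grad :: "(real \<times> real \<Rightarrow> real) \<Rightarrow> real \<times> real \<Rightarrow> real \<times> real" where
  "grad H = (\<lambda>(x, y). (deriv (\<lambda>\<xi>. H (\<xi>, y)) x, deriv (\<lambda>\<eta>. H (x, \<eta>)) y))"

definition C1_on :: "'a::real_normed_vector set \<Rightarrow> ('a \<Rightarrow> 'b::real_normed_vector) \<Rightarrow> bool" where
  "C1_on S f \<longleftrightarrow> (\<exists>f' :: 'a \<Rightarrow> 'a \<Rightarrow>\<^sub>L 'b. continuous_on S f' \<and>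
      (\<forall>p\<in>S. (f has_derivative blinfun_apply (f' p)) (at p)))"

definition C2_on :: "'a::real_normed_vector set \<Rightarrow> ('a \<Rightarrow> 'b::real_normed_vector) \<Rightarrow> bool" where
  "C2_on S f \<longleftrightarrow> (\<exists>f' :: 'a \<Rightarrow> 'a \<Rightarrow>\<^sub>L 'b. C1_on S f' \<and>
      (\<forall>p\<in>S. (f has_derivative blinfun_apply (f' p)) (at p)))"

text \<open>The equation \<open>div (\<nabla>\<sigma> (\<nabla>H)) = 0\<close>.  Both partial derivatives are required to exist, so that the
  equation is never satisfied through a default value of \<^const>\<open>deriv\<close>.\<close>

definition Euler_Lagrange :: "real \<Rightarrow> (real \<times> real) set \<Rightarrow> (real \<times> real \<Rightarrow> real) \<Rightarrow> bool" where
  "Euler_Lagrange r U H \<longleftrightarrow> (\<forall>(x, y)\<in>U. \<exists>X\<^sub>x Y\<^sub>y.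
      ((\<lambda>\<xi>. sigma_s r (grad H (\<xi>, y))) has_real_derivative X\<^sub>x) (at x) \<and>
      ((\<lambda>\<eta>. sigma_t r (grad H (x, \<eta>))) has_real_derivative Y\<^sub>y) (at y) \<and>
      X\<^sub>x + Y\<^sub>y = 0)"

text \<open>Local coordinates: \<open>f\<close> maps \<open>V\<close> onto \<open>W\<close> with inverse \<open>h\<close>, both continuously differentiable.\<close>

definition C1_diffeomorphism ::
  "'a::real_normed_vector set \<Rightarrow> 'b::real_normed_vector set \<Rightarrow> ('a \<Rightarrow> 'b) \<Rightarrow> ('b \<Rightarrow> 'a) \<Rightarrow> bool" where
  "C1_diffeomorphism V W f h \<longleftrightarrow>
      open V \<and> open W \<and> homeomorphism V W f h \<and> C1_on V f \<and> C1_on W h"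

end

theory Submission
  imports Defs
begin

text \<open>Put \<open>a = \<pi> - arg (u - 1)\<close>, \<open>b = arg (u - r\<^sup>2)\<close>, \<open>c = arg u\<close>.  The triangle with vertices \<open>r\<^sup>2\<close>, \<open>1\<close>,
\<open>u\<close> has the angles \<open>b\<close> at \<open>r\<^sup>2\<close> and \<open>a\<close> at \<open>1\<close>, so \<open>\<theta> = a + b\<close> is the supplement of its angle at
\<open>u\<close>, and the slope satisfies \<open>s \<theta> = a\<close>, \<open>t \<theta> = b - c\<close>.  The argument has four ingredients.

\<^item> The correspondence between slopes and points of the upper half plane.  Given \<open>(s, t)\<close>, the point
  \<open>u\<close> is determined by \<open>\<theta>\<close>, and \<open>\<theta>\<close> solves one trigonometric equation.  A certain quotient of sines
  increases strictly with \<open>\<theta>\<close>, which gives uniqueness (\<open>angle_ratio_strict_increasing\<close>); the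
  inequality that defines the interior of \<open>\<N>\<^sup>*\<close> decides the sign as \<open>\<theta>\<close> tends to 0, which gives
  existence (\<open>angle_equation_solvable\<close>).

\<^item> A complex first-order equation.  In \<open>dB\<close> only terms of the form \<open>arg \<cdot> d log|\<cdot>|\<close> survive, so the
  Euler--Lagrange equation is linear in the real parts of the logarithmic derivatives of \<open>u\<close>,
  \<open>u - 1\<close> and \<open>u - r\<^sup>2\<close>.  Multiplied by \<open>\<theta>\<close>, the integrability condition \<open>s\<^sub>y = t\<^sub>x\<close> is the same
  expression in their imaginary parts.  Together they say \<open>P u\<^sub>y = Q u\<^sub>x\<close> with
  \<open>P = u - r\<^sup>2 - (1 - r\<^sup>2) s\<close> and \<open>Q = r\<^sup>2 (1 / u - 1) - (1 - r\<^sup>2) t\<close> (\<open>complex_burgers\<close>).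

\<^item> The function \<open>g = (u - r\<^sup>2) x + r\<^sup>2 (1 / u - 1) y - (1 - r\<^sup>2) H\<close>.  Since \<open>dH = s dx + t dy\<close>, the
  differential \<open>dg\<close> is \<open>P dx + Q dy\<close> up to a multiple of \<open>du\<close>, and \<open>P u\<^sub>y = Q u\<^sub>x\<close> makes \<open>P dx + Q dy\<close>
  a multiple of \<open>du\<close> as well.  So \<open>g\<close> is holomorphic in \<open>u\<close>
  (\<open>legendre_field_differentiable\<close>).  The formulas for \<open>H\<close> and \<open>y\<close> are the conjugate and the
  imaginary part of the definition of \<open>g\<close>.

\<^item> The potential \<open>\<Phi> = r\<^sup>2 \<theta> (s x + t y - H)\<close>.  In \<open>d\<Phi>\<close> the terms with \<open>dx\<close>, \<open>dy\<close>, \<open>dH\<close> cancel, and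
  what is left is \<open>Im (r\<^sup>2 g du / ((1 - u) (u - r\<^sup>2)))\<close> (\<open>potential_has_derivative\<close>).  Hence some
  antiderivative \<open>F\<close> has \<open>Im F = \<Phi>\<close>.  Now \<open>Re g\<close>, \<open>Im g\<close> and \<open>\<Phi>\<close> are three linear
  functions of \<open>x\<close>, \<open>y\<close>, \<open>H\<close>; eliminating \<open>y\<close> and \<open>H\<close> leaves the formula for \<open>x\<close>, whose denominator is
  negative on the upper half plane (\<open>weighted_angle_sum_pos\<close>, \<open>x_from_potential\<close>).\<close>


section \<open>Monotonicity of trigonometric quotients\<close>

lemma x_cos_less_sin:
  fixes x :: real
  assumes "0 < x" "x < pi"
  shows "x * cos x < sin x"
proof -
  have "(\<lambda>x. sin x - x * cos x) 0 < (\<lambda>x. sin x - x * cos x) x"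
  proof (rule DERIV_pos_imp_increasing_open[OF assms(1)])
    fix y :: real assume "0 < y" "y < x"
    then have "((\<lambda>x. sin x - x * cos x) has_real_derivative y * sin y) (at y)" "0 < y * sin y"
      using assms by (auto intro!: derivative_eq_intros mult_pos_pos sin_gt_zero)
    then show "\<exists>d. ((\<lambda>x. sin x - x * cos x) has_real_derivative d) (at y) \<and> 0 < d" by blast
  qed (intro continuous_intros)
  then show ?thesis by simp
qed

lemma sin_cos_less:
  fixes x :: real
  assumes "0 < x" "x < pi"
  shows "sin x * cos x < x"
proof -
  have s: "sin x > 0" "sin x \<le> x" using assms sin_gt_zero sin_x_le_x by auto
  have "cos x < 1" using cos_monotone_0_pi[of 0 x] assms by simp
  then have "sin x * cos x < sin x * 1" using s by (intro mult_strict_left_mono) auto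
  with s show ?thesis by linarith
qed

lemma sinc_strict_decreasing:
  fixes x y :: real
  assumes "0 < x" "x < y" "y < pi"
  shows "sin y / y < sin x / x"
proof (rule DERIV_neg_imp_decreasing[OF assms(2)])
  fix v :: real assume v: "x \<le> v" "v \<le> y"
  then have "v * cos v < sin v" "v > 0" using x_cos_less_sin assms by auto
  then show "\<exists>d. ((\<lambda>x. sin x / x) has_real_derivative d) (at v) \<and> d < 0"
    by (intro exI[of _ "(cos v * v - sin v) / (v * v)"])
       (auto intro!: derivative_eq_intros divide_neg_pos simp: field_simps)
qed

lemma x_cot_strict_decreasing:
  fixes x y :: real
  assumes "0 < x" "x < y" "y < pi"
  shows "y * cot y < x * cot x"
proof (rule DERIV_neg_imp_decreasing[OF assms(2)])
  fix v :: real assume v: "x \<le> v" "v \<le> y"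
  then have *: "sin v * cos v < v" "sin v > 0" using sin_cos_less sin_gt_zero assms by auto
  then have "((\<lambda>x. x * cot x) has_real_derivative cot v - v / (sin v)\<^sup>2) (at v)"
    by (auto intro!: derivative_eq_intros DERIV_cot simp: divide_inverse)
  also have "cot v - v / (sin v)\<^sup>2 = (sin v * cos v - v) / (sin v)\<^sup>2"
    using * by (simp add: cot_def field_simps power2_eq_square)
  finally show "\<exists>d. ((\<lambda>x. x * cot x) has_real_derivative d) (at v) \<and> d < 0"
    using * by (intro exI conjI) (assumption, auto intro!: divide_neg_pos)
qed

text \<open>The sign of the logarithmic derivative \<open>k cot (k v) - cot v\<close> is the monotonicity of \<open>v cot v\<close>,
  evaluated at \<open>k v < v\<close>.\<close>

lemma sin_quotient_strict_increasing:
  fixes k x y :: real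
  assumes "0 < k" "k < 1" "0 < x" "x < y" "y < pi"
  shows "sin (k * x) / sin x < sin (k * y) / sin y"
proof (rule DERIV_pos_imp_increasing[OF assms(4)])
  fix v :: real assume v: "x \<le> v" "v \<le> y"
  have kv: "0 < k * v" "k * v < v" using assms v by auto
  then have pos: "sin v > 0" "sin (k * v) > 0" "v > 0"
    using v assms sin_gt_zero[of v] sin_gt_zero[OF kv(1)] kv by auto
  have "v * cot v < (k * v) * cot (k * v)"
    using kv v assms by (intro x_cot_strict_decreasing) auto
  then have "v * (cos v * sin (k * v)) < v * (k * cos (k * v) * sin v)"
    using pos by (simp add: cot_def field_simps)
  then have "cos v * sin (k * v) < k * cos (k * v) * sin v" using pos by simp
  then show "\<exists>d. ((\<lambda>x. sin (k * x) / sin x) has_real_derivative d) (at v) \<and> 0 < d"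
    using pos by (intro exI[of _ "(k * cos (k * v) * sin v - sin (k * v) * cos v) / (sin v)\<^sup>2"])
       (auto intro!: derivative_eq_intros divide_pos_pos simp: field_simps power2_eq_square)
qed

text \<open>The quotient is the area of a circular segment with half-chord 1 and half-angle \<open>x\<close>.  Its
  derivative is \<open>2 (sin v - v cos v) / (sin v)\<^sup>3\<close>.\<close>

lemma segment_area_strict_increasing:
  fixes x y :: real
  assumes "0 < x" "x < y" "y < pi"
  shows "(x - sin x * cos x) / (sin x)\<^sup>2 < (y - sin y * cos y) / (sin y)\<^sup>2"
proof (rule DERIV_pos_imp_increasing[OF assms(2)])
  fix v :: real assume v: "x \<le> v" "v \<le> y"
  then have *: "v * cos v < sin v" "sin v > 0" using x_cos_less_sin sin_gt_zero assms by auto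
  have "((\<lambda>x. (x - sin x * cos x) / (sin x)\<^sup>2) has_real_derivative
     ((1 - (cos v * cos v - sin v * sin v)) * (sin v)\<^sup>2 - (v - sin v * cos v) * (2 * sin v * cos v))
      / ((sin v)\<^sup>2 * (sin v)\<^sup>2)) (at v)"
    using * by (auto intro!: derivative_eq_intros simp: algebra_simps)
  also have "((1 - (cos v * cos v - sin v * sin v)) * (sin v)\<^sup>2 - (v - sin v * cos v) * (2 * sin v * cos v))
     = 2 * sin v * (sin v - v * cos v)"
  proof -
    have "sin v * sin v = 1 - cos v * cos v"
      using sin_squared_eq[of v] by (simp add: power2_eq_square)
    then show ?thesis unfolding power2_eq_square by algebra
  qed
  finally show "\<exists>d. ((\<lambda>x. (x - sin x * cos x) / (sin x)\<^sup>2) has_real_derivative d) (at v) \<and> 0 < d"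
    using * by (intro exI conjI) (assumption, auto)
qed


section \<open>Arguments in the upper half plane\<close>

lemma Arg_upper: "Im u > 0 \<Longrightarrow> 0 < Arg u \<and> Arg u < pi"
  by (simp add: Arg_lt_pi)

lemma norm_sin_Arg: "cmod u * sin (Arg u) = Im u" and norm_cos_Arg: "cmod u * cos (Arg u) = Re u"
  using rcis_cmod_Arg[of u] by (metis Im_rcis, metis Re_rcis)

lemma Re_sin_Arg: "Re u * sin (Arg u) = Im u * cos (Arg u)"
  unfolding norm_sin_Arg[symmetric] norm_cos_Arg[symmetric] by simp

lemma Arg_upper_eqI:
  assumes "Im u > 0" "0 < a" "a < pi" "Re u * sin a = Im u * cos a"
  shows "Arg u = a"
proof (rule Arg_unique)
  have "sin a > 0" using assms sin_gt_zero by auto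
  then show "0 < Im u / sin a" "complex_of_real (Im u / sin a) * exp (\<i> * complex_of_real a) = u"
    using assms by (auto simp: complex_eq_iff cis_conv_exp[symmetric] field_simps)
qed (use assms in auto)

text \<open>Moving a point of the upper half plane to the left increases its argument: the sine of the
  difference of the two arguments has the sign of \<open>Im u \<cdot> (a' - a)\<close>.\<close>

lemma Arg_shift_less:
  fixes u :: complex and a a' :: real
  assumes "Im u > 0" "a < a'"
  shows "Arg (u - of_real a) < Arg (u - of_real a')"
proof (rule ccontr)
  define A B where "A = Arg (u - of_real a)" and "B = Arg (u - of_real a')"
  assume "\<not> ?thesis"
  then have le: "B \<le> A" unfolding A_def B_def by simp
  have bd: "0 < A" "A < pi" "0 < B" "B < pi"
    using Arg_upper[of "u - of_real a"] Arg_upper[of "u - of_real a'"] assms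
    unfolding A_def B_def by auto
  have pos: "cmod (u - of_real a) > 0" "cmod (u - of_real a') > 0"
    using assms by (auto simp: complex_eq_iff)
  have "cmod (u - of_real a) * cmod (u - of_real a') * sin (A - B)
      = (cmod (u - of_real a) * sin A) * (cmod (u - of_real a') * cos B)
        - (cmod (u - of_real a) * cos A) * (cmod (u - of_real a') * sin B)"
    by (simp add: sin_diff algebra_simps)
  also have "\<dots> = Im u * (a - a')"
    unfolding A_def B_def norm_sin_Arg norm_cos_Arg by (simp add: algebra_simps)
  also have "\<dots> < 0" using assms by (simp add: mult_pos_neg)
  finally have "sin (A - B) < 0" using pos by (simp add: mult_less_0_iff)
  moreover have "sin (A - B) \<ge> 0" using le bd by (intro sin_ge_zero) auto
  ultimately show False by simp
qed

text \<open>A triangle is determined by one side, here the segment from 0 to 1, and the two adjacent angles.\<close>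

lemma upper_eqI_Arg:
  fixes u v :: complex
  assumes "Im u > 0" "Im v > 0" "Arg u = Arg v" "Arg (u - 1) = Arg (v - 1)"
  shows "u = v"
proof -
  define a c where "a = Arg (v - 1)" and "c = Arg v"
  have "c < a" unfolding a_def c_def using Arg_shift_less[of v 0 1] assms by simp
  moreover have "0 < a" "a < pi" "0 < c" "c < pi"
    using Arg_upper[of v] Arg_upper[of "v - 1"] assms by (auto simp: a_def c_def)
  ultimately have pos: "sin (a - c) > 0" "sin c > 0" by (auto intro!: sin_gt_zero)
  have im: "Im w = sin a * sin c / sin (a - c)" and re: "Re w = Im w * cos c / sin c"
    if "Arg w = c" "Arg (w - 1) = a" for w
  proof -
    have e: "Re w * sin c = Im w * cos c" "(Re w - 1) * sin a = Im w * cos a"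
      using Re_sin_Arg[of w] Re_sin_Arg[of "w - 1"] that by auto
    then have "Im w * sin (a - c) = sin a * sin c" unfolding sin_diff by algebra
    then show "Im w = sin a * sin c / sin (a - c)" using pos by (simp add: field_simps)
    show "Re w = Im w * cos c / sin c" using e pos by (simp add: field_simps)
  qed
  have "Arg u = c" "Arg (u - 1) = a" "Arg v = c" "Arg (v - 1) = a"
    using assms by (auto simp: a_def c_def)
  then show ?thesis using im re by (simp add: complex_eq_iff)
qed

lemma Arg_chain:
  fixes r :: real and u :: complex
  assumes "0 < r" "r < 1" "Im u > 0"
  shows "0 < Arg u" "Arg u < Arg (u - r\<^sup>2)" "Arg (u - r\<^sup>2) < Arg (u - 1)" "Arg (u - 1) < pi"
proof -
  have "r\<^sup>2 < 1" using assms by (simp add: abs_square_less_1)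
  with assms Arg_shift_less[of u 0 "r\<^sup>2"] Arg_shift_less[of u "r\<^sup>2" 1]
    Arg_upper[of u] Arg_upper[of "u - 1"]
  show "0 < Arg u" "Arg u < Arg (u - r\<^sup>2)" "Arg (u - r\<^sup>2) < Arg (u - 1)" "Arg (u - 1) < pi"
    by auto
qed


section \<open>The point of the upper half plane attached to a slope\<close>

text \<open>The quotient factors as \<open>A / (f B)\<close> with \<open>A = sin ((s + t) x) / sin x\<close>, \<open>B = sin (m x) / x\<close>,
  \<open>m = 1 - s - t\<close>, and \<open>f = x (cot (s x) + cot (t x)) = x sin ((s + t) x) / (sin (s x) sin (t x))\<close>.
  All three are positive, \<open>A\<close> increases and \<open>f\<close>, \<open>B\<close> decrease.  Splitting off the more obvious
  factor \<open>sin (t x) / sin (m x)\<close> would fail, since it increases only when \<open>t < m\<close>.\<close>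

lemma angle_ratio_strict_increasing:
  fixes s t x y :: real
  assumes st: "0 < s" "0 < t" "s + t < 1" and xy: "0 < x" "x < y" "y < pi"
  shows "sin (s * x) * sin (t * x) / (sin x * sin ((1 - s - t) * x))
       < sin (s * y) * sin (t * y) / (sin y * sin ((1 - s - t) * y))"
proof -
  define m where "m = 1 - s - t"
  have m: "0 < m" "m < 1" using st by (auto simp: m_def)
  have scale: "0 < k * v \<and> k * v < pi \<and> sin (k * v) > 0"
    if "0 < k" "k \<le> 1" "0 < v" "v < pi" for k v :: real
  proof -
    have "k * v \<le> 1 * v" using that by (intro mult_right_mono) auto
    with that have "0 < k * v" "k * v < pi" by (simp, linarith)
    then show ?thesis using sin_gt_zero by blast
  qed
  define f where "f v = v * cot (s * v) + v * cot (t * v)" for v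
  define A where "A v = sin ((s + t) * v) / sin v" for v
  define B where "B v = sin (m * v) / v" for v
  have pos: "f v > 0" "A v > 0" "B v > 0"
    and split: "sin (s * v) * sin (t * v) / (sin v * sin (m * v)) = A v / (f v * B v)"
    if v: "0 < v" "v < pi" for v
  proof -
    note sc = scale[of s v] scale[of t v] scale[of "s + t" v] scale[of m v] scale[of 1 v]
    have p: "sin (s * v) > 0" "sin (t * v) > 0" "sin ((s + t) * v) > 0" "sin (m * v) > 0" "sin v > 0"
      using sc v m st by auto
    have f: "f v = v * sin ((s + t) * v) / (sin (s * v) * sin (t * v))"
      using p unfolding f_def cot_def by (simp add: field_simps sin_add)
    show "f v > 0" "A v > 0" "B v > 0" using p v by (auto simp: f A_def B_def)
    show "sin (s * v) * sin (t * v) / (sin v * sin (m * v)) = A v / (f v * B v)"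
      unfolding f A_def B_def using p v by (simp add: field_simps)
  qed
  have cot_less: "y * cot (k * y) < x * cot (k * x)" if "0 < k" "k < 1" for k
  proof -
    have "k * y * cot (k * y) < k * x * cot (k * x)"
      using that xy scale[of k x] scale[of k y] by (intro x_cot_strict_decreasing) auto
    then have "k * (y * cot (k * y)) < k * (x * cot (k * x))" by (simp add: mult.assoc)
    then show ?thesis using that by simp
  qed
  have f: "f y < f x" unfolding f_def using st by (intro add_strict_mono cot_less) auto
  have A: "A x < A y" unfolding A_def using st xy by (intro sin_quotient_strict_increasing) auto
  have "sin (m * y) / (m * y) < sin (m * x) / (m * x)"
    using m xy scale[of m x] scale[of m y] by (intro sinc_strict_decreasing) auto
  then have "B y / m < B x / m" unfolding B_def by (simp add: mult.commute)
  then have B: "B y < B x" using m by (simp add: divide_less_cancel)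
  have x: "f x > 0" "A x > 0" "B x > 0" and y: "f y > 0" "A y > 0" "B y > 0"
    using pos[of x] pos[of y] xy by auto
  have "A x / (f x * B x) < A y / (f y * B y)"
    using x y A B f by (intro frac_less mult_strict_mono mult_mono) auto
  then show ?thesis unfolding m_def[symmetric] using split[of x] split[of y] xy by simp
qed

text \<open>This is the law of sines in the triangles with vertices 0, \<open>r\<^sup>2\<close>, \<open>u\<close> and \<open>r\<^sup>2\<close>, 1, \<open>u\<close>, which share the
  side from \<open>r\<^sup>2\<close> to \<open>u\<close>: their sides on the real axis have the lengths \<open>r\<^sup>2\<close> and \<open>1 - r\<^sup>2\<close>, hence
  \<open>r\<^sup>2 / (1 - r\<^sup>2) = sin (b - c) sin a / (sin c sin (a + b))\<close>.\<close>

lemma angle_equation: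
  fixes r :: real and u :: complex
  assumes "Im u > 0"
  defines "a \<equiv> pi - Arg (u - 1)" and "b \<equiv> Arg (u - r\<^sup>2)" and "c \<equiv> Arg u"
  shows "(1 - r\<^sup>2) * (sin a * sin (b - c)) = r\<^sup>2 * (sin (a + b) * sin c)"
proof -
  define a' where "a' = Arg (u - 1)"
  note e = Re_sin_Arg[of u, folded c_def]
  have e1: "(Re u - 1) * sin a' = Im u * cos a'"
    using Re_sin_Arg[of "u - 1", folded a'_def] by simp
  have e2: "(Re u - r\<^sup>2) * sin b = Im u * cos b"
    using Re_sin_Arg[of "u - r\<^sup>2", folded b_def] by (simp add: b_def)
  have sa: "sin a = sin a'" unfolding a_def a'_def by simp
  have sab: "sin (a + b) = sin a' * cos b - cos a' * sin b"
    unfolding a_def a'_def[symmetric] by (simp add: sin_add sin_diff cos_diff)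
  have "Im u * ((1 - r\<^sup>2) * (sin a * sin (b - c))) = Im u * (r\<^sup>2 * (sin (a + b) * sin c))"
    unfolding sa sab sin_diff using e e1 e2 by algebra
  then show ?thesis using assms(1) by simp
qed

text \<open>Divided by \<open>\<theta>\<^sup>2\<close>, the difference of the two sides tends to \<open>r\<^sup>2 (1 - s - t) - (1 - r\<^sup>2) s t\<close> as
  \<open>\<theta>\<close> tends to 0.  This is positive exactly by the inequality that cuts out the interior of \<open>\<N>\<^sup>*\<close>,
  while at \<open>\<theta> = \<pi>\<close> the difference is negative; so it vanishes in between.\<close>

lemma angle_equation_solvable:
  fixes r s t :: real
  assumes r: "0 < r" "r < 1" and st: "(s, t) \<in> interior_Nstar r"
  shows "s + t < 1" "\<exists>\<theta>. 0 < \<theta> \<and> \<theta> < pi \<and>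
    (1 - r\<^sup>2) * (sin (s * \<theta>) * sin (t * \<theta>)) = r\<^sup>2 * (sin \<theta> * sin ((1 - s - t) * \<theta>))"
proof -
  have r2: "0 < r\<^sup>2" "r\<^sup>2 < 1" using r by (auto simp: abs_square_less_1)
  have pos: "s > 0" "t > 0" and lt: "(1 - r\<^sup>2) / r\<^sup>2 * s * t + s + t - 1 < 0"
    using st by (auto simp: interior_Nstar_def)
  have "(1 - r\<^sup>2) / r\<^sup>2 * s * t > 0" using r2 pos by (intro mult_pos_pos) auto
  with lt show st1: "s + t < 1" by linarith
  define f where "f \<theta> = r\<^sup>2 * (sin \<theta> * sin ((1 - s - t) * \<theta>)) - (1 - r\<^sup>2) * (sin (s * \<theta>) * sin (t * \<theta>))"
    for \<theta> :: real
  have lim: "((\<lambda>x. sin (k * x) / x) \<longlongrightarrow> k) (at_right 0)" for k :: real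
  proof -
    have "((\<lambda>x. sin (k * x)) has_real_derivative k) (at 0)" by (auto intro!: derivative_eq_intros)
    then show ?thesis by (auto simp: has_field_derivative_iff intro: filterlim_at_split[THEN iffD1, THEN conjunct2])
  qed
  have "((\<lambda>x. r\<^sup>2 * (sin (1 * x) / x * (sin ((1 - s - t) * x) / x)) -
      (1 - r\<^sup>2) * (sin (s * x) / x * (sin (t * x) / x))) \<longlongrightarrow>
        r\<^sup>2 * (1 * (1 - s - t)) - (1 - r\<^sup>2) * (s * t)) (at_right 0)"
    by (intro tendsto_intros lim)
  moreover have "r\<^sup>2 * (1 * (1 - s - t)) - (1 - r\<^sup>2) * (s * t) > 0"
    using lt r2 by (simp add: field_simps)
  ultimately have "\<forall>\<^sub>F x in at_right 0. r\<^sup>2 * (sin (1 * x) / x * (sin ((1 - s - t) * x) / x)) -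
      (1 - r\<^sup>2) * (sin (s * x) / x * (sin (t * x) / x)) > 0"
    by (rule order_tendstoD)
  moreover have "\<forall>\<^sub>F x :: real in at_right 0. x \<in> {0<..<pi}"
    by (rule eventually_at_right_real) simp
  ultimately have "\<forall>\<^sub>F x in at_right 0. 0 < x \<and> x < pi \<and> f x > 0"
  proof eventually_elim
    case (elim x)
    then have "0 < x * x * (r\<^sup>2 * (sin (1 * x) / x * (sin ((1 - s - t) * x) / x)) -
      (1 - r\<^sup>2) * (sin (s * x) / x * (sin (t * x) / x)))" by (intro mult_pos_pos) auto
    also have "\<dots> = f x" using elim unfolding f_def by (simp add: field_simps)
    finally show ?case using elim by auto
  qed
  then obtain x0 where x0: "0 < x0" "x0 < pi" "f x0 > 0"
    using eventually_happens'[of "at_right (0::real)"] by auto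
  have "s * pi < pi" "t * pi < pi" using pos st1 by auto
  then have "sin (s * pi) > 0" "sin (t * pi) > 0" using pos by (auto intro!: sin_gt_zero)
  then have fpi: "f pi < 0" using r2 unfolding f_def by simp
  have "\<exists>x\<ge>x0. x \<le> pi \<and> f x = 0"
    using x0 fpi by (intro IVT2') (auto simp: f_def intro!: continuous_intros)
  then obtain x where "x0 \<le> x" "x \<le> pi" "f x = 0" by blast
  moreover from this fpi have "x \<noteq> pi" by auto
  ultimately show "\<exists>\<theta>. 0 < \<theta> \<and> \<theta> < pi \<and>
    (1 - r\<^sup>2) * (sin (s * \<theta>) * sin (t * \<theta>)) = r\<^sup>2 * (sin \<theta> * sin ((1 - s - t) * \<theta>))"
    using x0 by (intro exI[of _ x]) (auto simp: f_def)
qed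

text \<open>The point is the apex of the triangle over the segment from 0 to 1 with angle \<open>c\<close> at 0 and angle
  \<open>a\<close> at 1.  Its argument as seen from \<open>r\<^sup>2\<close> is then prescribed by the equation for \<open>\<theta>\<close>.\<close>

lemma angle_point_exists:
  fixes r s t :: real
  assumes r: "0 < r" "r < 1" and st: "0 < s" "0 < t" "s + t < 1" and th: "0 < \<theta>" "\<theta> < pi"
    and eq: "(1 - r\<^sup>2) * (sin (s * \<theta>) * sin (t * \<theta>)) = r\<^sup>2 * (sin \<theta> * sin ((1 - s - t) * \<theta>))"
  shows "\<exists>u::complex. Im u > 0 \<and> Arg (u - 1) = pi - s * \<theta> \<and> Arg (u - r\<^sup>2) = (1 - s) * \<theta> \<and> Arg u = (1 - s - t) * \<theta>"
proof -
  define a b c where "a = s * \<theta>" and "b = (1 - s) * \<theta>" and "c = (1 - s - t) * \<theta>"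
  have abc: "0 < a" "0 < c" "c < b" "a + b = \<theta>" "b - c = t * \<theta>"
    using st th mult_pos_pos[of "1 - s - t" \<theta>] mult_pos_pos[of s \<theta>] mult_pos_pos[of t \<theta>]
    by (auto simp: a_def b_def c_def algebra_simps)
  have s: "sin a > 0" "sin b > 0" "sin c > 0" "sin (a + c) > 0"
    using abc th by (auto intro!: sin_gt_zero)
  define q p where "q = sin a * sin c / sin (a + c)" and "p = sin a * cos c / sin (a + c)"
  have eq': "(1 - r\<^sup>2) * (sin a * sin (b - c)) = r\<^sup>2 * (sin (a + b) * sin c)"
    using eq abc(4,5) unfolding a_def c_def by simp
  have "(p - r\<^sup>2) * sin b = q * cos b"
  proof -
    have "sin (a + c) * sin b * r\<^sup>2 = sin a * sin (b - c)"
    proof -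
      have "sin a * sin (b - c) = r\<^sup>2 * (sin (a + b) * sin c + sin a * sin (b - c))"
        using eq' by algebra
      moreover have "sin (a + b) * sin c + sin a * sin (b - c) = sin (a + c) * sin b"
        by (simp add: sin_add sin_diff algebra_simps)
      ultimately show ?thesis by (metis mult.commute)
    qed
    then show ?thesis using s unfolding p_def q_def by (simp add: field_simps sin_diff)
  qed
  moreover have "p * sin c = q * cos c" by (simp add: p_def q_def)
  moreover have "(p - 1) * sin (pi - a) = q * cos (pi - a)"
    using s unfolding p_def q_def by (simp add: field_simps sin_add)
  moreover have "q > 0" using s by (simp add: q_def)
  ultimately have "Arg (Complex p q - 1) = pi - a" "Arg (Complex p q - r\<^sup>2) = b" "Arg (Complex p q) = c"
    using abc th by (auto intro!: Arg_upper_eqI)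
  then show ?thesis using \<open>q > 0\<close> unfolding a_def b_def c_def
    by (intro exI[of _ "Complex p q"]) auto
qed

text \<open>Two solutions for the same slope have the same quotient of sines, hence the same \<open>\<theta>\<close> and the same
  angles; so the description that defines \<^const>\<open>u_point\<close> has exactly one solution.\<close>

lemma u_point_properties:
  fixes r :: real
  assumes r: "0 < r" "r < 1" and st: "st \<in> interior_Nstar r"
  defines "u \<equiv> u_point r st"
  shows "Im u > 0" "fst st * theta r u = pi - Arg (u - 1)"
    "snd st * theta r u = Arg (u - r\<^sup>2) - Arg u" "(1 - fst st - snd st) * theta r u = Arg u"
proof -
  obtain s t where st_eq: "st = (s, t)" by fastforce
  have r2: "0 < r\<^sup>2" "r\<^sup>2 < 1" using r by (auto simp: abs_square_less_1)
  have pos: "0 < s" "0 < t" using st by (auto simp: interior_Nstar_def st_eq)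
  have sum: "s + t < 1" using angle_equation_solvable(1)[OF r] st st_eq by blast
  let ?P = "\<lambda>u::complex. Im u > 0 \<and>
      s * theta r u = pi - Arg (u - 1) \<and>
      t * theta r u = Arg (u - r\<^sup>2) - Arg u \<and>
      (1 - s - t) * theta r u = Arg u"
  obtain \<theta> where \<theta>: "0 < \<theta>" "\<theta> < pi"
    "(1 - r\<^sup>2) * (sin (s * \<theta>) * sin (t * \<theta>)) = r\<^sup>2 * (sin \<theta> * sin ((1 - s - t) * \<theta>))"
    using angle_equation_solvable(2)[OF r] st st_eq by blast
  from angle_point_exists[OF r pos sum this] obtain u0 where u0:
    "Im u0 > 0" "Arg (u0 - 1) = pi - s * \<theta>" "Arg (u0 - r\<^sup>2) = (1 - s) * \<theta>" "Arg u0 = (1 - s - t) * \<theta>"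
    by blast
  have "theta r u0 = \<theta>" using u0 by (simp add: theta_def algebra_simps)
  then have ex: "?P u0" using u0 by (auto simp: algebra_simps)
  have *: "0 < theta r v \<and> theta r v < pi \<and>
      sin (s * theta r v) * sin (t * theta r v) / (sin (theta r v) * sin ((1 - s - t) * theta r v))
       = r\<^sup>2 / (1 - r\<^sup>2)" if v: "?P v" for v
  proof -
    have i: "Im v > 0" using v by blast
    from Arg_chain[OF r i] have th: "0 < theta r v" "theta r v < pi" by (auto simp: theta_def)
    have p: "sin (theta r v) > 0" "sin (Arg v) > 0"
      using th Arg_upper[OF i] by (auto intro!: sin_gt_zero)
    have "(1 - r\<^sup>2) * (sin (s * theta r v) * sin (t * theta r v))
        = r\<^sup>2 * (sin (theta r v) * sin ((1 - s - t) * theta r v))"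
      using angle_equation[OF i, of r] v unfolding theta_def[symmetric] by (elim conjE) simp
    moreover have "sin ((1 - s - t) * theta r v) > 0" using p v by simp
    ultimately show ?thesis using th p r2 by (simp add: field_simps)
  qed
  have uniq: "v = v'" if v: "?P v" and v': "?P v'" for v v' :: complex
  proof -
    have "theta r v = theta r v'"
      using *[OF v] *[OF v'] angle_ratio_strict_increasing[OF pos sum, of "theta r v" "theta r v'"]
        angle_ratio_strict_increasing[OF pos sum, of "theta r v'" "theta r v"]
      by (smt (verit))
    then have "Arg v = Arg v'" "Arg (v - 1) = Arg (v' - 1)" using v v' by auto
    then show ?thesis using v v' by (intro upper_eqI_Arg) auto
  qed
  have "u = (THE u. ?P u)" unfolding u_def u_point_def st_eq by simp
  moreover have "?P (THE u. ?P u)" using ex uniq by (intro theI[of ?P u0]) blast+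
  ultimately have "?P u" by (simp only:)
  then show "Im u > 0" "fst st * theta r u = pi - Arg (u - 1)"
    "snd st * theta r u = Arg (u - r\<^sup>2) - Arg u" "(1 - fst st - snd st) * theta r u = Arg u"
    by (auto simp: st_eq)
qed


section \<open>The function A at w and z\<close>

lemma Arg_cis_eq: "\<lbrakk>0 < \<rho>; - pi < a; a \<le> pi; z = of_real \<rho> * cis a\<rbrakk> \<Longrightarrow> Arg z = a"
  by (rule Arg_unique[of \<rho>]) (auto simp: cis_conv_exp)

lemma Arg_w_z:
  fixes r :: real and u :: complex
  assumes r: "0 < r" "r < 1" and u: "Im u > 0"
  shows "Arg (w_of r u) = pi - Arg (u - 1)" "Arg (1 - w_of r u) = - Arg (u - r\<^sup>2)"
    "Arg (z_of r u) = Arg u - Arg (u - r\<^sup>2)" "Arg (1 - z_of r u) = pi - Arg (u - 1) + Arg u"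
    "Arg (cnj (z_of r u)) = Arg (u - r\<^sup>2) - Arg u" 
    "Arg (1 - cnj (z_of r u)) = - (pi - Arg (u - 1) + Arg u)"
proof -
  note chain = Arg_chain[OF r u]
  define d where "d = 1 - r\<^sup>2"
  have d: "d > 0" "complex_of_real d = 1 - (of_real r)\<^sup>2" using r by (auto simp: d_def abs_square_less_1)
  have pos: "cmod u > 0" "cmod (u - 1) > 0" "cmod (u - r\<^sup>2) > 0" using u by (auto simp: complex_eq_iff)
  have nz: "u \<noteq> 0" "1 - complex_of_real (r\<^sup>2) \<noteq> 0" using u d by auto
  have pol: "cnj v = of_real (cmod v) * cis (- Arg v)" for v
    by (metis cis_cnj complex_cnj_complex_of_real complex_cnj_mult rcis_cmod_Arg rcis_def)
  have pol1: "1 - cnj u = of_real (cmod (u - 1)) * cis (pi - Arg (u - 1))"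
  proof -
    have "cis (pi - Arg (u - 1)) = - cis (- Arg (u - 1))" by (simp add: complex_eq_iff)
    then show ?thesis using pol[of "u - 1"] by (metis complex_cnj_diff complex_cnj_one minus_diff_eq mult_minus_right)
  qed
  have polr: "cnj u - r\<^sup>2 = of_real (cmod (u - r\<^sup>2)) * cis (- Arg (u - r\<^sup>2))"
    using pol[of "u - r\<^sup>2"] by simp
  have w: "w_of r u = (1 - cnj u) / of_real d" and w1: "1 - w_of r u = (cnj u - r\<^sup>2) / of_real d"
    and z: "z_of r u = (cnj u - r\<^sup>2) / (of_real d * cnj u)"
    and z1: "1 - z_of r u = r\<^sup>2 * (1 - cnj u) / (of_real d * cnj u)"
    using nz by (auto simp: w_of_def z_of_def d_def field_simps)
  show "Arg (w_of r u) = pi - Arg (u - 1)"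
    by (rule Arg_cis_eq[of "cmod (u - 1) / d"]) (use pos d chain in \<open>auto simp: w pol1\<close>)
  have w1c: "1 - w_of r u = of_real (cmod (u - r\<^sup>2) / d) * cis (- Arg (u - r\<^sup>2))"
    unfolding w1 polr by simp
  show "Arg (1 - w_of r u) = - Arg (u - r\<^sup>2)"
    by (rule Arg_cis_eq[OF _ _ _ w1c]) (use pos d chain in auto)
  have zc: "z_of r u = of_real (cmod (u - r\<^sup>2) / (d * cmod u)) * cis (Arg u - Arg (u - r\<^sup>2))"
  proof -
    have "cis (Arg u - Arg (u - r\<^sup>2)) = cis (- Arg (u - r\<^sup>2)) / cis (- Arg u)" unfolding cis_divide by simp
    then show ?thesis unfolding z polr unfolding pol[of u] by simp
  qed
  have z1c: "1 - z_of r u = of_real (r\<^sup>2 * cmod (u - 1) / (d * cmod u)) * cis (pi - Arg (u - 1) + Arg u)"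
  proof -
    have "cis (pi - Arg (u - 1) + Arg u) = cis (pi - Arg (u - 1)) / cis (- Arg u)" unfolding cis_divide by simp
    then show ?thesis unfolding z1 pol1 unfolding pol[of u] by (simp add: mult.assoc)
  qed
  show "Arg (z_of r u) = Arg u - Arg (u - r\<^sup>2)"
    by (rule Arg_cis_eq[OF _ _ _ zc]) (use pos d chain in auto)
  show "Arg (1 - z_of r u) = pi - Arg (u - 1) + Arg u"
    by (rule Arg_cis_eq[OF _ _ _ z1c]) (use pos d chain r in auto)
  show "Arg (cnj (z_of r u)) = Arg (u - r\<^sup>2) - Arg u"
    by (rule Arg_cis_eq[of "cmod (u - r\<^sup>2) / (d * cmod u)"])
       (use pos d chain in \<open>auto simp: zc cis_cnj\<close>)
  have "1 - cnj (z_of r u) = cnj (1 - z_of r u)" by simp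
  then show "Arg (1 - cnj (z_of r u)) = - (pi - Arg (u - 1) + Arg u)"
    by (intro Arg_cis_eq[of "r\<^sup>2 * cmod (u - 1) / (d * cmod u)"])
       (use pos d chain r in \<open>auto simp: z1c cis_cnj\<close>)
qed

text \<open>The numerators are the conjugates of \<open>\<theta> P\<close> and of \<open>- u \<theta> Q\<close>, where \<open>P\<close> and \<open>Q\<close> are the coefficients
  in the complex equation \<open>P u\<^sub>y = Q u\<^sub>x\<close>.\<close>

lemma fun_A_w_z:
  fixes r :: real and u :: complex
  assumes r: "0 < r" "r < 1" and u: "Im u > 0"
  defines "a \<equiv> complex_of_real (pi - Arg (u - 1))" and "b \<equiv> complex_of_real (Arg (u - r\<^sup>2))"
    and "c \<equiv> complex_of_real (Arg u)"
  shows "fun_A (w_of r u) = ((cnj u - 1) * a + (cnj u - r\<^sup>2) * b) / of_real (pi * (1 - r\<^sup>2))"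
    "fun_A (z_of r u) = ((cnj u - r\<^sup>2) * (b - c) - r\<^sup>2 * (1 - cnj u) * (a + c)) / (of_real (pi * (1 - r\<^sup>2)) * cnj u)"
proof -
  have nz: "u \<noteq> 0" using u by auto
  have "r\<^sup>2 < 1" using r by (simp add: abs_square_less_1)
  then have d: "1 - complex_of_real (r\<^sup>2) \<noteq> 0" by (metis eq_iff_diff_eq_0 less_irrefl of_real_1 of_real_eq_iff)
  have w: "1 - w_of r u = (cnj u - r\<^sup>2) / (1 - complex_of_real (r\<^sup>2))"
    and z1: "1 - z_of r u = r\<^sup>2 * (1 - cnj u) / ((1 - complex_of_real (r\<^sup>2)) * cnj u)"
    and z: "z_of r u = (cnj u - r\<^sup>2) / ((1 - complex_of_real (r\<^sup>2)) * cnj u)"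
    using nz d by (auto simp: w_of_def z_of_def field_simps)
  show "fun_A (w_of r u) = ((cnj u - 1) * a + (cnj u - r\<^sup>2) * b) / of_real (pi * (1 - r\<^sup>2))"
  proof -
    have "fun_A (w_of r u) = 1 / pi * (- w_of r u * a + (1 - w_of r u) * b)"
      unfolding fun_A_def Arg_w_z[OF r u] a_def b_def by simp
    then show ?thesis unfolding w unfolding w_of_def using d by (simp add: field_simps)
  qed
  show "fun_A (z_of r u) = ((cnj u - r\<^sup>2) * (b - c) - r\<^sup>2 * (1 - cnj u) * (a + c)) / (of_real (pi * (1 - r\<^sup>2)) * cnj u)"
  proof -
    have "fun_A (z_of r u) = 1 / pi * (z_of r u * (b - c) - (1 - z_of r u) * (a + c))"
      unfolding fun_A_def Arg_w_z[OF r u] a_def b_def c_def by simp (simp add: algebra_simps)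
    then show ?thesis unfolding z1 unfolding z using d nz by (simp add: field_simps)
  qed
qed

text \<open>Up to the factor \<open>-1 / (\<pi> (1 - r\<^sup>2))\<close> this is the denominator in the formula for \<open>x\<close>; see
  \<open>fun_A_difference\<close>.\<close>

definition weighted_angle_sum :: "real \<Rightarrow> complex \<Rightarrow> real" where
  "weighted_angle_sum r u = r\<^sup>2 * (cmod (u - 1))\<^sup>2 * (pi - Arg (u - 1))
     + (cmod (u - r\<^sup>2))\<^sup>2 * Arg (u - r\<^sup>2) - (1 - r\<^sup>2) * (cmod u)\<^sup>2 * Arg u"

text \<open>Write each term \<open>N\<^sup>2 v\<close>, with \<open>N sin v = Im u\<close>, as \<open>(Im u)\<^sup>2 l v + (N sin v) (N cos v)\<close>, where \<open>l\<close> is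
  the segment area.  The products \<open>N cos v\<close> are \<open>1 - Re u\<close>, \<open>Re u - r\<^sup>2\<close> and \<open>Re u\<close>, and their weighted
  sum vanishes.  There remains \<open>r\<^sup>2 l a + l b - (1 - r\<^sup>2) l c\<close>, which is positive because \<open>l\<close> is positive and
  increasing and \<open>c < b\<close>.\<close>

lemma weighted_angle_sum_pos:
  fixes r :: real and u :: complex
  assumes r: "0 < r" "r < 1" and u: "Im u > 0"
  shows "weighted_angle_sum r u > 0"
proof -
  define a b c where "a = pi - Arg (u - 1)" and "b = Arg (u - r\<^sup>2)" and "c = Arg u"
  have r2: "0 < r\<^sup>2" "r\<^sup>2 < 1" using r by (auto simp: abs_square_less_1)
  have abc: "0 < a" "a < pi" "0 < c" "c < b" "b < pi"
    using Arg_chain[OF r u] unfolding a_def b_def c_def by auto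
  define l where "l v = (v - sin v * cos v) / (sin v)\<^sup>2" for v :: real
  have l0: "l v > 0" if "0 < v" "v < pi" for v
    using sin_cos_less[OF that] sin_gt_zero[OF that] unfolding l_def by simp
  have expand: "N\<^sup>2 * v = (Im u)\<^sup>2 * l v + (N * sin v) * (N * cos v)"
    if "N * sin v = Im u" "0 < v" "v < pi" for N v
    using sin_gt_zero[OF that(2,3)] unfolding that(1)[symmetric] l_def
    by (simp add: field_simps power2_eq_square)
  have sc: "cmod (u - 1) * sin a = Im u" "cmod (u - 1) * cos a = 1 - Re u"
    "cmod (u - r\<^sup>2) * sin b = Im u" "cmod (u - r\<^sup>2) * cos b = Re u - r\<^sup>2"
    "cmod u * sin c = Im u" "cmod u * cos c = Re u"
    using norm_sin_Arg[of "u - 1"] norm_cos_Arg[of "u - 1"] norm_sin_Arg[of "u - r\<^sup>2"]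
      norm_cos_Arg[of "u - r\<^sup>2"] norm_sin_Arg[of u] norm_cos_Arg[of u]
    unfolding a_def b_def c_def by (auto simp del: of_real_power)
  have e: "(cmod (u - 1))\<^sup>2 * a = (Im u)\<^sup>2 * l a + Im u * (1 - Re u)"
     "(cmod (u - r\<^sup>2))\<^sup>2 * b = (Im u)\<^sup>2 * l b + Im u * (Re u - r\<^sup>2)"
     "(cmod u)\<^sup>2 * c = (Im u)\<^sup>2 * l c + Im u * Re u"
    using expand[OF sc(1)] expand[OF sc(3)] expand[OF sc(5)] abc unfolding sc by auto
  have "weighted_angle_sum r u = r\<^sup>2 * ((cmod (u - 1))\<^sup>2 * a) + (cmod (u - r\<^sup>2))\<^sup>2 * b
      - (1 - r\<^sup>2) * ((cmod u)\<^sup>2 * c)"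
    unfolding weighted_angle_sum_def a_def b_def c_def by simp
  also have "\<dots> = (Im u)\<^sup>2 * (r\<^sup>2 * l a + l b - (1 - r\<^sup>2) * l c)"
    unfolding e by (simp add: algebra_simps)
  finally have eq: "weighted_angle_sum r u = (Im u)\<^sup>2 * (r\<^sup>2 * l a + l b - (1 - r\<^sup>2) * l c)" .
  have "l c < l b" unfolding l_def using abc by (intro segment_area_strict_increasing) auto
  moreover have "r\<^sup>2 * l a > 0" "r\<^sup>2 * l c > 0" using l0[of a] l0[of c] abc r2 by auto
  ultimately have "r\<^sup>2 * l a + l b - (1 - r\<^sup>2) * l c > 0" by (simp add: algebra_simps)
  then show ?thesis unfolding eq using u by (intro mult_pos_pos) auto
qed

lemma fun_A_difference:
  fixes r :: real and u :: complex
  assumes r: "0 < r" "r < 1" and u: "Im u > 0"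
  shows "r\<^sup>2 * fun_A (w_of r u) - (cmod u)\<^sup>2 * fun_A (z_of r u)
     = of_real (- weighted_angle_sum r u / (pi * (1 - r\<^sup>2)))"
proof -
  have nz: "u \<noteq> 0" "cnj u \<noteq> 0" using u by auto
  have r2: "r\<^sup>2 < 1" using r by (simp add: abs_square_less_1)
  define K where "K = complex_of_real (pi * (1 - r\<^sup>2))"
  have "pi * (1 - r\<^sup>2) \<noteq> 0" using r2 by simp
  then have K: "K \<noteq> 0" unfolding K_def of_real_eq_0_iff .
  have N: "complex_of_real ((cmod v)\<^sup>2) = v * cnj v" for v by (rule complex_norm_square)
  define a b c where "a = complex_of_real (pi - Arg (u - 1))" and "b = complex_of_real (Arg (u - r\<^sup>2))"
    and "c = complex_of_real (Arg u)"
  have "r\<^sup>2 * fun_A (w_of r u) - (cmod u)\<^sup>2 * fun_A (z_of r u)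
     = (r\<^sup>2 * ((cnj u - 1) * a + (cnj u - r\<^sup>2) * b)
        - u * ((cnj u - r\<^sup>2) * (b - c) - r\<^sup>2 * (1 - cnj u) * (a + c))) / K"
  proof -
    have *: "u * cnj u * (Y / (K * cnj u)) = u * Y / K" for Y using nz by simp
    show ?thesis
      unfolding fun_A_w_z[OF r u] K_def[symmetric] a_def[symmetric] b_def[symmetric] c_def[symmetric] N *
      by (simp only: diff_divide_distrib times_divide_eq_right)
  qed
  also have "r\<^sup>2 * ((cnj u - 1) * a + (cnj u - r\<^sup>2) * b)
        - u * ((cnj u - r\<^sup>2) * (b - c) - r\<^sup>2 * (1 - cnj u) * (a + c))
      = - (r\<^sup>2 * ((u - 1) * cnj (u - 1)) * a + (u - r\<^sup>2) * cnj (u - r\<^sup>2) * b - (1 - r\<^sup>2) * (u * cnj u) * c)"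
    by (simp add: algebra_simps)
  also have "\<dots> = of_real (- weighted_angle_sum r u)"
    unfolding weighted_angle_sum_def of_real_add of_real_diff of_real_mult of_real_minus N a_def b_def c_def
    by simp
  finally show ?thesis unfolding K_def by simp
qed


section \<open>The differential of B\<close>

lemma has_derivative_Arg:
  assumes "(f has_derivative f') (at x)" "Im (f x) > 0"
  shows "((\<lambda>x. Arg (f x)) has_derivative (\<lambda>h. Im (f' h / f x))) (at x)"
proof -
  have nz: "f x \<noteq> 0" "f x \<notin> \<real>\<^sub>\<le>\<^sub>0" using assms(2) by (auto simp: complex_nonpos_Reals_iff)
  have "(Ln has_derivative (\<lambda>h. inverse (f x) * h)) (at (f x))"
    using has_field_derivative_Ln[OF nz(2)] by (simp add: has_field_derivative_def)
  from has_derivative_compose[OF assms(1) this]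
  have d: "((\<lambda>x. Im (Ln (f x))) has_derivative (\<lambda>h. Im (inverse (f x) * f' h))) (at x)"
    by (rule has_derivative_Im)
  have e: "\<forall>\<^sub>F y in at x. Im (Ln (f y)) = Arg (f y)"
  proof -
    have "(f \<longlongrightarrow> f x) (at x)"
      using has_derivative_continuous[OF assms(1)] by (simp add: continuous_within)
    then have "((\<lambda>y. Im (f y)) \<longlongrightarrow> Im (f x)) (at x)" by (intro tendsto_intros)
    then have "\<forall>\<^sub>F y in at x. Im (f y) > 0" using assms(2) by (rule order_tendstoD)
    then show ?thesis by eventually_elim (auto intro!: Arg_eq_Im_Ln[symmetric])
  qed
  have "((\<lambda>x. Arg (f x)) has_derivative (\<lambda>h. Im (inverse (f x) * f' h))) (at x)"
    using d e by (rule has_derivative_transform_eventually) (use nz Arg_eq_Im_Ln in auto)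
  then show ?thesis by (simp add: divide_inverse mult.commute)
qed

text \<open>The plane without the real half-line from 1 to \<open>\<infinity>\<close> is starlike about 0, and \<open>Ln (1 - \<zeta>) / \<zeta>\<close> has a
  removable singularity at 0; so the integral along the segment is a difference of values of a
  primitive.\<close>

lemma dilog_has_field_derivative:
  assumes "Im z \<noteq> 0"
  shows "(dilog has_field_derivative - Ln (1 - z) / z) (at z)"
proof -
  define S :: "complex set" where "S = {z. 1 - z \<notin> \<real>\<^sub>\<le>\<^sub>0}"
  define f :: "complex \<Rightarrow> complex" where "f = (\<lambda>\<zeta>. if \<zeta> = 0 then - 1 else Ln (1 - \<zeta>) / \<zeta>)"
  have S_eq: "S = (\<lambda>z. 1 - z) -` (- \<real>\<^sub>\<le>\<^sub>0)" by (auto simp: S_def)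
  have oS: "open S" unfolding S_eq
    by (intro open_vimage) (auto intro!: continuous_intros)
  have zS: "z \<in> S" "0 \<in> S" "\<And>z. Im z \<noteq> 0 \<Longrightarrow> z \<in> S"
    using assms by (auto simp: S_def complex_nonpos_Reals_iff)
  have seg: "closed_segment 0 x \<subseteq> S" if "x \<in> S" for x
  proof
    fix y assume "y \<in> closed_segment 0 x"
    then obtain k where k: "0 \<le> k" "k \<le> 1" "y = k *\<^sub>R x" by (auto simp: in_segment)
    show "y \<in> S"
    proof (rule ccontr)
      assume "y \<notin> S"
      then have y: "Im y = 0" "1 \<le> Re y" by (auto simp: S_def complex_nonpos_Reals_iff)
      then have "k \<noteq> 0" using k by auto
      then have "Im x = 0" using y k by simp
      moreover have "Re x \<ge> 1"
      proof (rule ccontr)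
        assume "\<not> Re x \<ge> 1"
        then have "k * Re x < k * 1" using \<open>k \<noteq> 0\<close> k by (intro mult_strict_left_mono) auto
        then show False using y k by simp
      qed
      ultimately show False using that by (auto simp: S_def complex_nonpos_Reals_iff)
    qed
  qed
  have star: "starlike S" unfolding starlike_def using zS(2) seg by blast
  have dLn: "((\<lambda>\<zeta>. Ln (1 - \<zeta>)) has_field_derivative - inverse (1 - x)) (at x)" if "x \<in> S" for x
    using that unfolding S_def by (auto intro!: derivative_eq_intros)
  have fd: "f field_differentiable (at x)" if x: "x \<in> S - {0}" for x
  proof -
    have "((\<lambda>\<zeta>. Ln (1 - \<zeta>) / \<zeta>) has_field_derivative
        (- inverse (1 - x) * x - Ln (1 - x) * 1) / (x * x)) (at x)"
      using x by (intro DERIV_divide dLn DERIV_ident) auto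
    then have "(f has_field_derivative (- inverse (1 - x) * x - Ln (1 - x) * 1) / (x * x)) (at x)"
      by (rule has_field_derivative_transform_within_open[where S = "- {0}"])
         (use x in \<open>auto simp: f_def\<close>)
    then show ?thesis by (auto simp: field_differentiable_def)
  qed
  have "continuous_on S f"
  proof (rule continuous_at_imp_continuous_on, rule ballI)
    fix x assume x: "x \<in> S"
    show "isCont f x"
    proof (cases "x = 0")
      case True
      (* The value - 1 at 0 is the difference quotient limit of Ln (1 - z). *)
      have "((\<lambda>\<zeta>. (Ln (1 - \<zeta>) - Ln (1 - 0)) / (\<zeta> - 0)) \<longlongrightarrow> - inverse (1 - 0)) (at 0)"
        using dLn[OF zS(2)] by (simp add: has_field_derivative_iff)
      then have "((\<lambda>\<zeta>. Ln (1 - \<zeta>) / \<zeta>) \<longlongrightarrow> - 1) (at 0)" by simp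
      then have "(f \<longlongrightarrow> - 1) (at 0)"
        by (rule Lim_transform_eventually) (auto simp: f_def eventually_at_filter)
      then show ?thesis using True by (simp add: isCont_def f_def)
    next
      case False
      then show ?thesis using fd x field_differentiable_imp_continuous_at by blast
    qed
  qed
  from holomorphic_starlike_primitive[OF this star oS finite.insertI[OF finite.emptyI] fd]
  obtain G where G: "\<And>x. x \<in> S \<Longrightarrow> (G has_field_derivative f x) (at x)" by blast
  have dilog_eq: "dilog x = - (G x - G 0)" if "x \<in> S" "x \<noteq> 0" for x
  proof -
    have "(f has_contour_integral (G (pathfinish (linepath 0 x)) - G (pathstart (linepath 0 x)))) (linepath 0 x)"
    proof (rule contour_integral_primitive[where S = S])
      show "(G has_field_derivative f v) (at v within S)" if "v \<in> S" for v
        using G[OF that] by (rule has_field_derivative_at_within)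
      show "path_image (linepath 0 x) \<subseteq> S" using seg[OF that(1)] by (simp only: path_image_linepath)
    qed (rule valid_path_linepath)
    then have "((\<lambda>t. f (linepath 0 x t) * (x - 0)) has_integral G x - G 0) {0..1}"
      by (simp add: has_contour_integral_linepath)
    (* The integrands differ only at the endpoint 0, where division by zero gives the value 0. *)
    then have "((\<lambda>t. Ln (1 - linepath 0 x t) / linepath 0 x t * (x - 0)) has_integral G x - G 0) {0..1}"
      by (rule has_integral_spike_finite[where S = "{0}", rotated 2])
         (use that in \<open>auto simp: f_def linepath_def\<close>)
    then have "((\<lambda>\<zeta>. Ln (1 - \<zeta>) / \<zeta>) has_contour_integral G x - G 0) (linepath 0 x)"
      by (simp add: has_contour_integral_linepath)
    then show ?thesis unfolding dilog_def by (simp add: contour_integral_unique)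
  qed
  have "((\<lambda>x. - (G x - G 0)) has_field_derivative - f z) (at z)"
    using G[OF zS(1)] by (auto intro!: derivative_eq_intros)
  then have "(dilog has_field_derivative - f z) (at z)"
    by (rule has_field_derivative_transform_within_open[where S = "S - {0}"])
       (use zS oS assms dilog_eq in \<open>auto simp: open_delete\<close>)
  moreover have "z \<noteq> 0" using assms by auto
  ultimately show ?thesis by (simp add: f_def)
qed

text \<open>In \<open>d (Im Li) = - Im (Ln (1 - z) dz / z)\<close> the summand \<open>- ln|1 - z| d arg z\<close> cancels against the
  derivative of \<open>arg z\<close> in the product \<open>arg z ln|1 - z|\<close>.  What survives is
  \<open>arg z d ln|1 - z| - arg (1 - z) d ln|z|\<close>.\<close>

lemma fun_B_has_derivative:
  assumes "Im z > 0"
  shows "(fun_B has_derivative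
    (\<lambda>h. 1 / pi * (Arg z * Re (h / (z - 1)) - Arg (1 - z) * Re (h / z)))) (at z)"
proof -
  have nz: "z \<noteq> 0" "1 - z \<noteq> 0" "z - 1 \<noteq> 0" "1 - z \<notin> \<real>\<^sub>\<le>\<^sub>0" using assms
    by (auto simp: complex_nonpos_Reals_iff)
  have dA: "(Arg has_derivative (\<lambda>h. Im (h / z))) (at z)"
    using has_derivative_Arg[OF has_derivative_ident assms] .
  have "((\<lambda>z. Ln (1 - z)) has_field_derivative - inverse (1 - z)) (at z)"
    using nz by (auto intro!: derivative_eq_intros)
  then have "((\<lambda>z. Re (Ln (1 - z))) has_derivative (\<lambda>h. Re (- inverse (1 - z) * h))) (at z)"
    unfolding has_field_derivative_def by (rule has_derivative_Re)
  then have dL: "((\<lambda>z. ln (cmod (1 - z))) has_derivative (\<lambda>h. Re (- inverse (1 - z) * h))) (at z)"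
    by (rule has_derivative_transform_within_open[of _ _ _ _ "- {1}"]) (use nz in auto)
  have dD: "((\<lambda>z. Im (dilog z)) has_derivative (\<lambda>h. Im (- Ln (1 - z) / z * h))) (at z)"
    using dilog_has_field_derivative[of z] assms
    by (intro has_derivative_Im has_field_derivative_imp_has_derivative) simp
  have "(fun_B has_derivative (\<lambda>h. 1 / pi * (Arg z * Re (- inverse (1 - z) * h) + Im (h / z) * ln (cmod (1 - z))
        + Im (- Ln (1 - z) / z * h)))) (at z)"
    unfolding fun_B_def[abs_def] 
    by (intro has_derivative_mult_right has_derivative_add has_derivative_mult dA dL dD)
  moreover have "Arg z * Re (- inverse (1 - z) * h) + Im (h / z) * ln (cmod (1 - z))
        + Im (- Ln (1 - z) / z * h) = Arg z * Re (h / (z - 1)) - Arg (1 - z) * Re (h / z)" for h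
  proof -
    have "- inverse (1 - z) * h = h / (z - 1)" using nz by (simp add: field_simps)
    moreover have "Im (- Ln (1 - z) / z * h) = - (Re (Ln (1 - z)) * Im (h / z) + Im (Ln (1 - z)) * Re (h / z))"
    proof -
      have "- Ln (1 - z) / z * h = - (Ln (1 - z) * (h / z))" by simp
      then show ?thesis by (simp only: uminus_complex.sel times_complex.sel)
    qed
    ultimately show ?thesis using nz by (simp add: Arg_eq_Im_Ln)
  qed
  ultimately show ?thesis by (simp only:)
qed


lemma Im_w_z_pos:
  fixes r :: real and u :: complex
  assumes r: "0 < r" "r < 1" and u: "Im u > 0"
  shows "Im (w_of r u) > 0" "Im (cnj (z_of r u)) > 0"
proof -
  have d: "1 - r\<^sup>2 > 0" using r by (simp add: abs_square_less_1)
  have w: "w_of r u = (1 - cnj u) / of_real (1 - r\<^sup>2)" by (simp add: w_of_def)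
  show "Im (w_of r u) > 0" unfolding w Im_divide_of_real using u d by simp
  have z: "cnj (z_of r u) = (1 - of_real (r\<^sup>2) / u) / of_real (1 - r\<^sup>2)" by (simp add: z_of_def)
  have "Im (of_real (r\<^sup>2) / u) < 0"
    using u r by (simp add: Im_divide power2_eq_square add_nonneg_pos)
  then show "Im (cnj (z_of r u)) > 0" unfolding z Im_divide_of_real using d by (auto simp: divide_less_0_iff)
qed

lemma fun_B_z_has_derivative:
  fixes r :: real and f :: "'a :: real_normed_vector \<Rightarrow> complex"
  assumes r: "0 < r" "r < 1" and f: "(f has_derivative f') (at p)" and u: "Im (f p) > 0"
  defines "u \<equiv> f p"
  shows "((\<lambda>p. fun_B (cnj (z_of r (f p)))) has_derivative
    (\<lambda>h. 1 / pi * ((Arg (u - r\<^sup>2) - Arg u) * Re (f' h * (1 / (u - 1) - 1 / u))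
      + (pi - Arg (u - 1) + Arg u) * Re (f' h * (1 / (u - r\<^sup>2) - 1 / u))))) (at p)"
proof -
  have d: "1 - complex_of_real (r\<^sup>2) \<noteq> 0"
    using r by (metis abs_square_less_1 abs_of_pos diff_gt_0_iff_gt less_irrefl of_real_1 of_real_diff of_real_eq_0_iff)
  have nz: "u \<noteq> 0" "u - 1 \<noteq> 0" "u - r\<^sup>2 \<noteq> 0" using u unfolding u_def[symmetric] by (auto simp: complex_eq_iff)
  define D where "D = r\<^sup>2 / (u\<^sup>2 * (1 - complex_of_real (r\<^sup>2)))"
  have "((\<lambda>v. (1 - of_real (r\<^sup>2) / v) / (1 - of_real (r\<^sup>2))) has_field_derivative D) (at u)"
  proof -
    have "((\<lambda>v. (1 - a / v) / k) has_field_derivative a / (u\<^sup>2 * k)) (at u)" if "k \<noteq> 0" for a k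
      using nz that by (auto intro!: derivative_eq_intros simp: power2_eq_square)
    from this[OF d] show ?thesis unfolding D_def .
  qed
  then have "((\<lambda>v. cnj (z_of r v)) has_field_derivative D) (at u)"
    by (simp add: z_of_def)
  then have "((\<lambda>v. cnj (z_of r v)) has_derivative (\<lambda>h. D * h)) (at (f p))"
    unfolding u_def by (rule has_field_derivative_imp_has_derivative)
  from has_derivative_compose[OF f this]
  have "((\<lambda>p. cnj (z_of r (f p))) has_derivative (\<lambda>h. D * f' h)) (at p)" .
  from has_derivative_compose[OF this fun_B_has_derivative[OF Im_w_z_pos(2)[OF r u]]]
  have B: "((\<lambda>p. fun_B (cnj (z_of r (f p)))) has_derivative (\<lambda>h. 1 / pi *
     (Arg (cnj (z_of r u)) * Re (D * f' h / (cnj (z_of r u) - 1))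
       - Arg (1 - cnj (z_of r u)) * Re (D * f' h / cnj (z_of r u))))) (at p)"
    unfolding u_def .
  define \<rho> K where "\<rho> = complex_of_real (r\<^sup>2)" and "K = 1 - \<rho>"
  have K: "K \<noteq> 0" "\<rho> \<noteq> 0" using d r by (auto simp: K_def \<rho>_def)
  have nz': "u \<noteq> 0" "u \<noteq> 1" "u \<noteq> \<rho>" using nz by (auto simp: \<rho>_def)
  have z: "cnj (z_of r u) = (u - \<rho>) / (u * K)"
  proof -
    have "cnj (z_of r u) = (1 - \<rho> / u) / K" by (simp add: z_of_def K_def \<rho>_def)
    also have "1 - \<rho> / u = (u - \<rho>) / u" using nz' by (simp add: diff_divide_distrib)
    finally show ?thesis by simp
  qed
  have "cnj (z_of r u) - 1 = (u - \<rho> - u * K) / (u * K)"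
    unfolding z using nz' K by (simp add: diff_divide_distrib)
  also have "u - \<rho> - u * K = \<rho> * (u - 1)" unfolding K_def by (simp add: algebra_simps)
  finally have z1: "cnj (z_of r u) - 1 = \<rho> * (u - 1) / (u * K)" .
  have D: "D = \<rho> / (u\<^sup>2 * K)" by (simp add: D_def K_def \<rho>_def)
  have 1: "D * h / (cnj (z_of r u) - 1) = h * (1 / (u - 1) - 1 / u)" for h
    unfolding z1 D using nz' K by (simp add: divide_simps power2_eq_square)
  have 2: "D * h / cnj (z_of r u) = h * (1 / (u - r\<^sup>2) - 1 / u)" for h
    unfolding z D \<rho>_def[symmetric] using nz' K by (simp add: divide_simps power2_eq_square)
  show ?thesis
    using B unfolding 1 2 Arg_w_z(5,6)[OF r u[folded u_def]] mult_minus_left diff_minus_eq_add .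
qed

lemma fun_B_w_has_derivative:
  fixes r :: real and f :: "'a :: real_normed_vector \<Rightarrow> complex"
  assumes r: "0 < r" "r < 1" and f: "(f has_derivative f') (at p)" and u: "Im (f p) > 0"
  defines "u \<equiv> f p"
  shows "((\<lambda>p. fun_B (w_of r (f p))) has_derivative
    (\<lambda>h. 1 / pi * ((pi - Arg (u - 1)) * Re (f' h * (1 / (u - r\<^sup>2)))
      + Arg (u - r\<^sup>2) * Re (f' h * (1 / (u - 1)))))) (at p)"
proof -
  have d: "1 - complex_of_real (r\<^sup>2) \<noteq> 0"
    using r by (metis abs_square_less_1 abs_of_pos diff_gt_0_iff_gt less_irrefl of_real_1 of_real_diff of_real_eq_0_iff)
  define K where "K = 1 - complex_of_real (r\<^sup>2)"
  have nz: "cnj u - 1 \<noteq> 0" "cnj u - r\<^sup>2 \<noteq> 0" using u unfolding u_def[symmetric] by (auto simp: complex_eq_iff)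
  have K: "K \<noteq> 0" "complex_of_real (r\<^sup>2) = 1 - K" using d by (auto simp: K_def)
  have weq: "w_of r = (\<lambda>v. (1 - cnj v) / K)" by (simp add: w_of_def K_def fun_eq_iff)
  have "((\<lambda>p. (1 - cnj (f p)) / K) has_derivative (\<lambda>h. (0 - cnj (f' h)) / K)) (at p)"
    by (intro bounded_linear.has_derivative[OF bounded_linear_divide] has_derivative_diff has_derivative_const has_derivative_cnj f) 
  then have "((\<lambda>p. w_of r (f p)) has_derivative (\<lambda>h. - cnj (f' h) / K)) (at p)"
    unfolding weq by simp
  from has_derivative_compose[OF this fun_B_has_derivative[OF Im_w_z_pos(1)[OF r u]]]
  have B: "((\<lambda>p. fun_B (w_of r (f p))) has_derivative (\<lambda>h. 1 / pi *
     (Arg (w_of r u) * Re (- cnj (f' h) / K / (w_of r u - 1))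
       - Arg (1 - w_of r u) * Re (- cnj (f' h) / K / w_of r u)))) (at p)"
    unfolding u_def .
  have K1: "K * (w_of r u - 1) = r\<^sup>2 - cnj u" and K2: "K * w_of r u = 1 - cnj u"
    unfolding weq right_diff_distrib using K by simp_all
  have swap: "- c / (v - v') = c / (v' - v)" for c v v' :: complex
    by (metis minus_diff_eq minus_divide_divide)
  have 1: "- cnj h / K / (w_of r u - 1) = cnj (h * (1 / (u - r\<^sup>2)))"
    and 2: "- cnj h / K / w_of r u = cnj (h * (1 / (u - 1)))" for h
    unfolding divide_divide_eq_left K1 K2 swap by simp_all
  show ?thesis
    using B unfolding 1 2 Arg_w_z(1,2)[OF r u[folded u_def]] cnj.simps mult_minus_left diff_minus_eq_add .
qed


section \<open>Symmetry of second derivatives\<close>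

text \<open>By the mean value theorem the second difference is \<open>h\<close> times an increment of \<open>s\<close> over a vertical
  distance \<open>h\<close>, and differentiability of \<open>s\<close> at the corner evaluates that increment.\<close>

lemma second_difference_quotient:
  fixes H s :: "real \<times> real \<Rightarrow> real"
  assumes U: "open U" "(a, b) \<in> U"
    and H: "\<And>\<xi> \<eta>. (\<xi>, \<eta>) \<in> U \<Longrightarrow> ((\<lambda>\<xi>. H (\<xi>, \<eta>)) has_real_derivative s (\<xi>, \<eta>)) (at \<xi>)"
    and s: "(s has_derivative L) (at (a, b))"
  shows "((\<lambda>h. (H (a + h, b + h) - H (a + h, b) - H (a, b + h) + H (a, b)) / h\<^sup>2) \<longlongrightarrow> L (0, 1)) (at_right 0)"
proof (rule tendstoI)
  fix e :: real assume e: "e > 0"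
  interpret L: bounded_linear L using s by (rule has_derivative_bounded_linear)
  obtain d1 where d1: "d1 > 0" "ball (a, b) d1 \<subseteq> U" using U openE by blast
  (* Two increments of s, each estimated at distance at most 2 h, give a total error of e h / 2. *)
  obtain d2 where d2: "d2 > 0" 
    "\<And>y. norm (y - (a, b)) < d2 \<Longrightarrow> \<bar>s y - s (a, b) - L (y - (a, b))\<bar> \<le> e / 8 * norm (y - (a, b))"
    using s e unfolding has_derivative_at_alt real_norm_def by (metis zero_less_divide_iff zero_less_numeral)
  define d where "d = min d1 d2"
  have small: "norm (k, l) < d \<and> norm (k, l) \<le> 2 * h \<and> (a + k, b + l) \<in> U"
    if "0 \<le> k" "k \<le> h" "0 \<le> l" "l \<le> h" "h < d / 2" for k l h :: real
  proof -
    have "norm (k, l) \<le> \<bar>k\<bar> + \<bar>l\<bar>" using norm_Pair_le[of k l] by simp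
    then have *: "norm (k, l) \<le> 2 * h" "norm (k, l) < d" using that by auto
    then have "(a + k, b + l) \<in> ball (a, b) d1" unfolding d_def
      by (simp add: dist_norm norm_Pair)
    with * d1 show ?thesis by blast
  qed
  have "\<forall>\<^sub>F h in at_right 0. h \<in> {0<..<d/2}"
    using d1 d2 by (intro eventually_at_right_real) (auto simp: d_def)
  then show "\<forall>\<^sub>F h in at_right 0.
    dist ((H (a + h, b + h) - H (a + h, b) - H (a, b + h) + H (a, b)) / h\<^sup>2) (L (0, 1)) < e"
  proof eventually_elim
    case (elim h)
    then have h: "0 < h" "h < d / 2" by auto
    define \<phi> where "\<phi> \<xi> = H (\<xi>, b + h) - H (\<xi>, b)" for \<xi>
    have "\<exists>z>a. z < a + h \<and> \<phi> (a + h) - \<phi> a = (a + h - a) * (s (z, b + h) - s (z, b))"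
    proof (rule MVT2)
      fix \<xi> assume "a \<le> \<xi>" "\<xi> \<le> a + h"
      then have "(\<xi>, b + h) \<in> U" "(\<xi>, b) \<in> U"
        using small[of "\<xi> - a" h h] small[of "\<xi> - a" h 0] h by auto
      then show "(\<phi> has_real_derivative s (\<xi>, b + h) - s (\<xi>, b)) (at \<xi>)"
        unfolding \<phi>_def[abs_def] by (intro DERIV_diff H)
    qed (use h in auto)
    then obtain z where z: "a < z" "z < a + h" "\<phi> (a + h) - \<phi> a = h * (s (z, b + h) - s (z, b))" by auto
    define k where "k = z - a"
    have k: "0 < k" "k < h" "z = a + k" using z by (auto simp: k_def)
    have n: "norm (k, h) < d" "norm (k, h) \<le> 2 * h" "norm (k, 0::real) < d" "norm (k, 0::real) \<le> 2 * h"
      using small[of k h h] small[of k h 0] k h by auto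
    have e1: "\<bar>s (z, b + h) - s (a, b) - L (k, h)\<bar> \<le> e / 8 * (2 * h)"
    proof (rule order_trans)
      show "\<bar>s (z, b + h) - s (a, b) - L (k, h)\<bar> \<le> e / 8 * norm (k, h)"
        using d2(2)[of "(z, b + h)"] n k by (simp add: d_def)
    qed (use n e in \<open>intro mult_left_mono; simp\<close>)
    have e2: "\<bar>s (z, b) - s (a, b) - L (k, 0)\<bar> \<le> e / 8 * (2 * h)"
    proof (rule order_trans)
      show "\<bar>s (z, b) - s (a, b) - L (k, 0)\<bar> \<le> e / 8 * norm (k, 0::real)"
        using d2(2)[of "(z, b)"] n k by (simp add: d_def)
    qed (use n e in \<open>intro mult_left_mono; simp\<close>)
    have "L (k, h) - L (k, 0) = h * L (0, 1)"
      using L.diff[of "(k, h)" "(k, 0)"] L.scaleR[of h "(0, 1)"] by simp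
    then have "\<bar>s (z, b + h) - s (z, b) - h * L (0, 1)\<bar> \<le> e / 2 * h"
      using e1 e2 unfolding abs_le_iff by (simp add: field_simps)
    moreover have "(H (a + h, b + h) - H (a + h, b) - H (a, b + h) + H (a, b)) / h\<^sup>2 - L (0, 1)
      = (s (z, b + h) - s (z, b) - h * L (0, 1)) / h"
    proof -
      have "H (a + h, b + h) - H (a + h, b) - H (a, b + h) + H (a, b) = h * (s (z, b + h) - s (z, b))"
        using z(3) unfolding \<phi>_def by simp
      then show ?thesis using h by (simp add: power2_eq_square diff_divide_distrib)
    qed
    ultimately have "\<bar>(H (a + h, b + h) - H (a + h, b) - H (a, b + h) + H (a, b)) / h\<^sup>2 - L (0, 1)\<bar> \<le> e / 2"
      using h by (simp add: abs_divide divide_le_eq)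
    then show ?case using e by (simp add: dist_real_def)
  qed
qed

text \<open>The second difference is symmetric in the two variables, so its limit computes both mixed
  partial derivatives.\<close>

lemma mixed_partials_eq:
  fixes H s t :: "real \<times> real \<Rightarrow> real"
  assumes U: "open U" "(a, b) \<in> U"
    and Hs: "\<And>\<xi> \<eta>. (\<xi>, \<eta>) \<in> U \<Longrightarrow> ((\<lambda>\<xi>. H (\<xi>, \<eta>)) has_real_derivative s (\<xi>, \<eta>)) (at \<xi>)"
    and Ht: "\<And>\<xi> \<eta>. (\<xi>, \<eta>) \<in> U \<Longrightarrow> ((\<lambda>\<eta>. H (\<xi>, \<eta>)) has_real_derivative t (\<xi>, \<eta>)) (at \<eta>)"
    and s: "(s has_derivative s') (at (a, b))" and t: "(t has_derivative t') (at (a, b))"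
  shows "s' (0, 1) = t' (1, 0)"
proof -
  have "open (prod.swap -` U)" by (intro open_vimage U continuous_intros)
  moreover have "((\<lambda>p. t (prod.swap p)) has_derivative (\<lambda>h. t' (prod.swap h))) (at (b, a))"
  proof -
    have "(prod.swap has_derivative (prod.swap :: real \<times> real \<Rightarrow> _)) (at (b, a))"
      unfolding prod.swap_def[abs_def] by (auto intro!: derivative_eq_intros)
    moreover have "(t has_derivative t') (at (prod.swap (b, a)))" using t by simp
    ultimately show ?thesis by (rule has_derivative_compose)
  qed
  ultimately have "((\<lambda>h. (H (a + h, b + h) - H (a, b + h) - H (a + h, b) + H (a, b)) / h\<^sup>2) \<longlongrightarrow> t' (1, 0)) (at_right 0)"
    using second_difference_quotient[of "prod.swap -` U" b a "\<lambda>p. H (prod.swap p)" "\<lambda>p. t (prod.swap p)"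
        "\<lambda>h. t' (prod.swap h)"] U Ht by simp
  moreover have "((\<lambda>h. (H (a + h, b + h) - H (a + h, b) - H (a, b + h) + H (a, b)) / h\<^sup>2) \<longlongrightarrow> s' (0, 1)) (at_right 0)"
    by (rule second_difference_quotient[OF U Hs s])
  ultimately show ?thesis
    by (intro tendsto_unique[of "at_right (0::real)"]) (simp_all add: algebra_simps)
qed

text \<open>What the equation needs from twice differentiability: \<open>dH = s dx + t dy\<close>, and \<open>s\<^sub>y = t\<^sub>x\<close>.\<close>

lemma C2_gradient:
  fixes H :: "real \<times> real \<Rightarrow> real"
  assumes U: "open U" and H: "C2_on U H" and p: "p \<in> U"
  shows "(H has_derivative (\<lambda>h. fst (grad H p) * fst h + snd (grad H p) * snd h)) (at p)"
    and "\<exists>s' t'. ((\<lambda>q. fst (grad H q)) has_derivative s') (at p) \<and>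
          ((\<lambda>q. snd (grad H q)) has_derivative t') (at p) \<and> s' (0, 1) = t' (1, 0)"
proof -
  from H obtain f' where C1: "C1_on U f'"
    and f': "\<And>p. p \<in> U \<Longrightarrow> (H has_derivative blinfun_apply (f' p)) (at p)"
    unfolding C2_on_def by blast
  from C1 obtain f'' where f'': "\<And>p. p \<in> U \<Longrightarrow> (f' has_derivative blinfun_apply (f'' p)) (at p)"
    unfolding C1_on_def by blast
  have s: "((\<lambda>\<xi>. H (\<xi>, b)) has_real_derivative f' (a, b) (1, 0)) (at a)" if "(a, b) \<in> U" for a b
  proof -
    have "((\<lambda>\<xi>. (\<xi>, b)) has_derivative (\<lambda>h. (h, 0))) (at a)" by (auto intro!: derivative_eq_intros)
    from has_derivative_compose[OF this f'[OF that]]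
    have "((\<lambda>\<xi>. H (\<xi>, b)) has_derivative (\<lambda>h. f' (a, b) (h, 0))) (at a)" .
    then show ?thesis
    proof (rule has_derivative_imp_has_field_derivative)
      show "h * f' (a, b) (1, 0) = f' (a, b) (h, 0)" for h
        using blinfun.scaleR_right[of "f' (a, b)" h "(1, 0)"] by simp
    qed
  qed
  have t: "((\<lambda>\<eta>. H (a, \<eta>)) has_real_derivative f' (a, b) (0, 1)) (at b)" if "(a, b) \<in> U" for a b
  proof -
    have "((\<lambda>\<eta>. (a, \<eta>)) has_derivative (\<lambda>h. (0, h))) (at b)" by (auto intro!: derivative_eq_intros)
    from has_derivative_compose[OF this f'[OF that]]
    have "((\<lambda>\<eta>. H (a, \<eta>)) has_derivative (\<lambda>h. f' (a, b) (0, h))) (at b)" .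
    then show ?thesis
    proof (rule has_derivative_imp_has_field_derivative)
      show "h * f' (a, b) (0, 1) = f' (a, b) (0, h)" for h
        using blinfun.scaleR_right[of "f' (a, b)" h "(0, 1)"] by simp
    qed
  qed
  have g: "grad H q = (f' q (1, 0), f' q (0, 1))" if "q \<in> U" for q
    using s[of "fst q" "snd q"] t[of "fst q" "snd q"] that
    by (auto simp: grad_def split: prod.splits intro!: DERIV_imp_deriv)
  have "f' p h = f' p (1, 0) * fst h + f' p (0, 1) * snd h" for h
  proof -
    have "h = fst h *\<^sub>R (1, 0) + snd h *\<^sub>R (0, 1)" by (simp add: prod_eq_iff)
    then have "f' p h = f' p (fst h *\<^sub>R (1, 0) + snd h *\<^sub>R (0, 1))" by (rule arg_cong)
    then show ?thesis unfolding blinfun.add_right blinfun.scaleR_right by (simp only: real_scaleR_def mult.commute)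
  qed
  then have "blinfun_apply (f' p) = (\<lambda>h. f' p (1, 0) * fst h + f' p (0, 1) * snd h)" by (rule ext)
  with f'[OF p] show "(H has_derivative (\<lambda>h. fst (grad H p) * fst h + snd (grad H p) * snd h)) (at p)"
    unfolding g[OF p] fst_conv snd_conv by (simp only:)
  have d: "((\<lambda>q. f' q v) has_derivative (\<lambda>h. f'' p h v)) (at p)" for v
    by (rule bounded_linear.has_derivative[OF blinfun.bounded_linear_left f''[OF p]])
  have ds: "((\<lambda>q. fst (grad H q)) has_derivative (\<lambda>h. f'' p h (1, 0))) (at p)"
    by (rule has_derivative_transform_within_open[OF d U p]) (simp add: g)
  have dt: "((\<lambda>q. snd (grad H q)) has_derivative (\<lambda>h. f'' p h (0, 1))) (at p)"
    by (rule has_derivative_transform_within_open[OF d U p]) (simp add: g)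
  obtain a b where ab: "p = (a, b)" by fastforce
  have "f'' p (0, 1) (1, 0) = f'' p (1, 0) (0, 1)"
    using mixed_partials_eq[OF U p[unfolded ab], of H "\<lambda>q. f' q (1, 0)" "\<lambda>q. f' q (0, 1)"] s t
      d[of "(1, 0)"] d[of "(0, 1)"] unfolding ab by blast
  with ds dt show "\<exists>s' t'. ((\<lambda>q. fst (grad H q)) has_derivative s') (at p) \<and>
          ((\<lambda>q. snd (grad H q)) has_derivative t') (at p) \<and> s' (0, 1) = t' (1, 0)"
    by blast
qed


section \<open>The Euler--Lagrange equation in complex form\<close>

lemma Re_of_real_times: "Re (of_real c * z) = c * Re z"
  and Im_of_real_times: "Im (of_real c * z) = c * Im z"
  by simp_all

lemma angle_has_derivative:
  fixes v :: "'a :: real_normed_vector \<Rightarrow> complex" and a :: real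
  assumes "(v has_derivative M) (at p)" "Im (v p) > 0"
  shows "((\<lambda>q. Arg (v q - of_real a)) has_derivative (\<lambda>h. Im (M h / (v p - of_real a)))) (at p)"
proof -
  have "((\<lambda>q. v q - of_real a) has_derivative (\<lambda>h. M h - 0)) (at p)"
    by (intro has_derivative_diff assms has_derivative_const)
  from has_derivative_Arg[OF this] show ?thesis using assms(2) by simp
qed

text \<open>Let \<open>a = \<pi> - arg (u - 1)\<close>, \<open>b = arg (u - r\<^sup>2)\<close>, \<open>c = arg u\<close>.  With \<open>E1 = 1 / (u - 1)\<close>, \<open>E2 = 1 / (u - r\<^sup>2)\<close>, \<open>E0 = 1 / u\<close> consider
  \<open>(b - c) (E1 - E0) u\<^sub>x + (a + c) (E2 - E0) u\<^sub>x + a E2 u\<^sub>y + b E1 u\<^sub>y\<close>.  Its real part is \<open>-\<pi>\<close> times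
  the left-hand side of the Euler--Lagrange equation, and its imaginary part is a multiple of
  \<open>s\<^sub>y - t\<^sub>x\<close>, found by differentiating \<open>s \<theta> = a\<close> and \<open>t \<theta> = b - c\<close>.  So the expression vanishes; it
  becomes the stated equation after multiplication by \<open>(u - 1) (u - r\<^sup>2)\<close> and division by \<open>\<theta>\<close>.\<close>

lemma complex_burgers:
  fixes r :: real and H :: "real \<times> real \<Rightarrow> real" and p :: "real \<times> real"
  assumes r: "0 < r" "r < 1" and U: "open U" and H: "C2_on U H"
    and slope: "\<And>p. p \<in> U \<Longrightarrow> grad H p \<in> interior_Nstar r"
    and EL: "Euler_Lagrange r U H" and p: "p \<in> U"
    and M: "((\<lambda>p. u_point r (grad H p)) has_derivative M) (at p)"
  defines "u \<equiv> u_point r (grad H p)" and "s \<equiv> fst (grad H p)" and "t \<equiv> snd (grad H p)"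
  shows "(u - of_real (r\<^sup>2) - of_real ((1 - r\<^sup>2) * s)) * M (0, 1)
    = (of_real (r\<^sup>2) * (1 / u - 1) - of_real ((1 - r\<^sup>2) * t)) * M (1, 0)"
proof -
  define v where "v = (\<lambda>p. u_point r (grad H p))"
  define a b c where "a = pi - Arg (u - 1)" and "b = Arg (u - r\<^sup>2)" and "c = Arg u"
  define \<rho> where "\<rho> = complex_of_real (r\<^sup>2)"
  note angle_eqs = u_point_properties[OF r slope]
  have u: "Im u > 0" "v p = u" using angle_eqs(1)[OF p] by (auto simp: u_def v_def)
  have th: "theta r u = a + b" by (simp add: theta_def a_def b_def)
  have angles: "s * (a + b) = a" "t * (a + b) = b - c"
    using angle_eqs[OF p] th unfolding u_def[symmetric] s_def[symmetric] t_def[symmetric]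
    by (simp_all add: a_def b_def c_def)
  have pos: "a + b > 0" using Arg_chain[OF r u(1)] unfolding a_def b_def by simp
  have Mv: "(v has_derivative M) (at p)" using M by (simp add: v_def)
  interpret M: bounded_linear M using M by (rule has_derivative_bounded_linear)
  obtain p1 p2 where pp: "p = (p1, p2)" by fastforce
  define ux uy where "ux = M (1, 0)" and "uy = M (0, 1)"
  define E1 E2 E0 where "E1 = 1 / (u - 1)" and "E2 = 1 / (u - \<rho>)" and "E0 = 1 / u"
  have Mx: "M (h, 0) = of_real h * ux" and My: "M (0, h) = of_real h * uy" for h
    using M.scaleR[of h "(1, 0)"] M.scaleR[of h "(0, 1)"] by (simp_all add: ux_def uy_def scaleR_conv_of_real)

  have EL': "(b - c) * Re (ux * (E1 - E0)) + (a + c) * Re (ux * (E2 - E0)) + a * Re (uy * E2) + b * Re (uy * E1) = 0"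
  proof -
    obtain Xx Yy where X: "((\<lambda>\<xi>. sigma_s r (grad H (\<xi>, p2))) has_real_derivative Xx) (at p1)"
      and Y: "((\<lambda>\<eta>. sigma_t r (grad H (p1, \<eta>))) has_real_derivative Yy) (at p2)" and XY: "Xx + Yy = 0"
      using EL p unfolding Euler_Lagrange_def pp by blast
    have "((\<lambda>\<xi>. (\<xi>, p2)) has_derivative (\<lambda>h. (h, 0))) (at p1)" by (auto intro!: derivative_eq_intros)
    from has_derivative_compose[OF this Mv[unfolded pp]]
    have dx: "((\<lambda>\<xi>. v (\<xi>, p2)) has_derivative (\<lambda>h. of_real h * ux)) (at p1)" unfolding Mx .
    have "((\<lambda>\<eta>. (p1, \<eta>)) has_derivative (\<lambda>h. (0, h))) (at p2)" by (auto intro!: derivative_eq_intros)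
    from has_derivative_compose[OF this Mv[unfolded pp]]
    have dy: "((\<lambda>\<eta>. v (p1, \<eta>)) has_derivative (\<lambda>h. of_real h * uy)) (at p2)" unfolding My .
    have X': "((\<lambda>\<xi>. sigma_s r (grad H (\<xi>, p2))) has_real_derivative
        - (1 / pi * ((b - c) * Re (ux * (E1 - E0)) + (a + c) * Re (ux * (E2 - E0))))) (at p1)"
    proof (rule has_derivative_imp_has_field_derivative)
      have "((\<lambda>\<xi>. - ln (1 - r\<^sup>2) - fun_B (cnj (z_of r (v (\<xi>, p2))))) has_derivative
        (\<lambda>h. 0 - (1 / pi * ((b - c) * Re (of_real h * ux * (E1 - E0))
          + (a + c) * Re (of_real h * ux * (E2 - E0)))))) (at p1)"
        using fun_B_z_has_derivative[OF r dx] u unfolding pp a_def b_def c_def E1_def E2_def E0_def \<rho>_def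
        by (intro has_derivative_diff has_derivative_const) simp
      then show "((\<lambda>\<xi>. sigma_s r (grad H (\<xi>, p2))) has_derivative
        (\<lambda>h. 0 - (1 / pi * ((b - c) * Re (of_real h * ux * (E1 - E0))
          + (a + c) * Re (of_real h * ux * (E2 - E0)))))) (at p1)"
        unfolding sigma_s_def v_def .
      show "h * - (1 / pi * ((b - c) * Re (ux * (E1 - E0)) + (a + c) * Re (ux * (E2 - E0)))) =
        0 - (1 / pi * ((b - c) * Re (of_real h * ux * (E1 - E0)) + (a + c) * Re (of_real h * ux * (E2 - E0))))"
        for h unfolding mult.assoc Re_of_real_times by (simp add: algebra_simps)
    qed
    have Y': "((\<lambda>\<eta>. sigma_t r (grad H (p1, \<eta>))) has_real_derivative
        - (1 / pi * (a * Re (uy * E2) + b * Re (uy * E1)))) (at p2)"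
    proof (rule has_derivative_imp_has_field_derivative)
      have "((\<lambda>\<eta>. - ln (1 - r\<^sup>2) - fun_B (w_of r (v (p1, \<eta>)))) has_derivative
        (\<lambda>h. 0 - (1 / pi * (a * Re (of_real h * uy * E2) + b * Re (of_real h * uy * E1))))) (at p2)"
        using fun_B_w_has_derivative[OF r dy] u unfolding pp a_def b_def c_def E1_def E2_def E0_def \<rho>_def
        by (intro has_derivative_diff has_derivative_const) simp
      then show "((\<lambda>\<eta>. sigma_t r (grad H (p1, \<eta>))) has_derivative
        (\<lambda>h. 0 - (1 / pi * (a * Re (of_real h * uy * E2) + b * Re (of_real h * uy * E1))))) (at p2)"
        unfolding sigma_t_def v_def .
      show "h * - (1 / pi * (a * Re (uy * E2) + b * Re (uy * E1))) =
        0 - (1 / pi * (a * Re (of_real h * uy * E2) + b * Re (of_real h * uy * E1)))"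
        for h unfolding mult.assoc Re_of_real_times by (simp add: algebra_simps)
    qed
    have "1 / pi * ((b - c) * Re (ux * (E1 - E0)) + (a + c) * Re (ux * (E2 - E0))
        + (a * Re (uy * E2) + b * Re (uy * E1))) = 0"
      using DERIV_unique[OF X X'] DERIV_unique[OF Y Y'] XY unfolding distrib_left by linarith
    then show ?thesis by simp
  qed

  have compat: "(b - c) * Im (ux * (E1 - E0)) + (a + c) * Im (ux * (E2 - E0)) + a * Im (uy * E2) + b * Im (uy * E1) = 0"
  proof -
    obtain s' t' where s': "((\<lambda>q. fst (grad H q)) has_derivative s') (at p)"
      and t': "((\<lambda>q. snd (grad H q)) has_derivative t') (at p)" and st: "s' (0, 1) = t' (1, 0)"
      using C2_gradient(2)[OF U H p] by blast
    have iv: "Im (v p) > 0" using u by simp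
    have d1: "((\<lambda>q. Arg (v q - 1)) has_derivative (\<lambda>h. Im (M h * E1))) (at p)"
      using angle_has_derivative[OF Mv iv, of 1] u(2) by (simp add: E1_def)
    have d2: "((\<lambda>q. Arg (v q - r\<^sup>2)) has_derivative (\<lambda>h. Im (M h * E2))) (at p)"
      using angle_has_derivative[OF Mv iv, of "r\<^sup>2"] u(2) unfolding E2_def \<rho>_def by simp
    have d0: "((\<lambda>q. Arg (v q)) has_derivative (\<lambda>h. Im (M h * E0))) (at p)"
      using angle_has_derivative[OF Mv iv, of 0] u(2) by (simp add: E0_def)
    have dth: "((\<lambda>q. theta r (v q)) has_derivative (\<lambda>h. 0 - Im (M h * E1) + Im (M h * E2))) (at p)"
      unfolding theta_def by (intro has_derivative_add has_derivative_diff has_derivative_const d1 d2)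
    have "((\<lambda>q. fst (grad H q) * theta r (v q)) has_derivative
       (\<lambda>h. s * (0 - Im (M h * E1) + Im (M h * E2)) + s' h * (a + b))) (at p)"
      using has_derivative_mult[OF s' dth] unfolding u(2) th s_def .
    then have "((\<lambda>q. pi - Arg (v q - 1)) has_derivative
       (\<lambda>h. s * (0 - Im (M h * E1) + Im (M h * E2)) + s' h * (a + b))) (at p)"
      by (rule has_derivative_transform_within_open[OF _ U p]) (use angle_eqs(2) in \<open>simp add: v_def\<close>)
    moreover have "((\<lambda>q. pi - Arg (v q - 1)) has_derivative (\<lambda>h. 0 - Im (M h * E1))) (at p)"
      by (intro has_derivative_diff has_derivative_const d1)
    ultimately have S: "s * (0 - Im (M h * E1) + Im (M h * E2)) + s' h * (a + b) = 0 - Im (M h * E1)" for h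
      by (rule fun_cong[OF has_derivative_unique])
    have "((\<lambda>q. snd (grad H q) * theta r (v q)) has_derivative
       (\<lambda>h. t * (0 - Im (M h * E1) + Im (M h * E2)) + t' h * (a + b))) (at p)"
      using has_derivative_mult[OF t' dth] unfolding u(2) th t_def .
    then have "((\<lambda>q. Arg (v q - r\<^sup>2) - Arg (v q)) has_derivative
       (\<lambda>h. t * (0 - Im (M h * E1) + Im (M h * E2)) + t' h * (a + b))) (at p)"
      by (rule has_derivative_transform_within_open[OF _ U p]) (use angle_eqs(3) in \<open>simp add: v_def\<close>)
    moreover have "((\<lambda>q. Arg (v q - r\<^sup>2) - Arg (v q)) has_derivative
        (\<lambda>h. Im (M h * E2) - Im (M h * E0))) (at p)"
      by (intro has_derivative_diff d2 d0)
    ultimately have T: "t * (0 - Im (M h * E1) + Im (M h * E2)) + t' h * (a + b) = Im (M h * E2) - Im (M h * E0)" for h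
      by (rule fun_cong[OF has_derivative_unique])
    define i1 i2 i0 j1 j2 where "i1 = Im (ux * E1)" and "i2 = Im (ux * E2)" and "i0 = Im (ux * E0)"
      and "j1 = Im (uy * E1)" and "j2 = Im (uy * E2)"
    have S1: "s * (j2 - j1) + s' (0, 1) * (a + b) = - j1"
      using S[of "(0, 1)", folded uy_def j1_def j2_def] by simp
    have T1: "t * (i2 - i1) + t' (1, 0) * (a + b) = i2 - i0"
      using T[of "(1, 0)", folded ux_def i1_def i2_def i0_def] by simp
    have "(b - c) * (i1 - i0) + (a + c) * (i2 - i0) + a * j2 + b * j1 = 0"
    proof -
      have "a * (j2 - j1) + s' (0, 1) * (a + b) * (a + b) = - j1 * (a + b)"
      proof -
        have "s * (a + b) * (j2 - j1) + s' (0, 1) * (a + b) * (a + b)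
            = (s * (j2 - j1) + s' (0, 1) * (a + b)) * (a + b)" by (simp add: algebra_simps)
        then show ?thesis unfolding S1 angles(1) .
      qed
      moreover have "(b - c) * (i2 - i1) + t' (1, 0) * (a + b) * (a + b) = (i2 - i0) * (a + b)"
      proof -
        have "t * (a + b) * (i2 - i1) + t' (1, 0) * (a + b) * (a + b)
            = (t * (i2 - i1) + t' (1, 0) * (a + b)) * (a + b)" by (simp add: algebra_simps)
        then show ?thesis unfolding T1 angles(2) .
      qed
      ultimately show ?thesis unfolding st by (simp add: algebra_simps)
    qed
    then show ?thesis unfolding i1_def i2_def i0_def j1_def j2_def by (simp only: right_diff_distrib minus_complex.sel)
  qed

  define A B C where "A = complex_of_real a" and "B = complex_of_real b" and "C = complex_of_real c"
  have nz: "u \<noteq> 0" "u - 1 \<noteq> 0" "u - \<rho> \<noteq> 0" using u(1) by (auto simp: complex_eq_iff \<rho>_def)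
  have main: "(B - C) * (ux * (E1 - E0)) + (A + C) * (ux * (E2 - E0)) + A * (uy * E2) + B * (uy * E1) = 0"
    using EL' compat unfolding A_def B_def C_def of_real_add[symmetric] of_real_diff[symmetric]
    by (simp only: complex_eq_iff plus_complex.sel Re_of_real_times Im_of_real_times zero_complex.sel)
  have inv: "E1 * (u - 1) = 1" "E2 * (u - \<rho>) = 1" "E0 * u = 1" using nz by (simp_all add: E1_def E2_def E0_def)
  define S T where "S = complex_of_real s" and "T = complex_of_real t"
  have ang: "S * (A + B) = A" "T * (A + B) = B - C"
    using angles unfolding S_def T_def A_def B_def C_def
    by (metis of_real_add of_real_mult, metis of_real_add of_real_mult of_real_diff)
  have AB: "A + B \<noteq> 0" using pos unfolding A_def B_def by (metis less_irrefl of_real_add of_real_eq_0_iff)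
  define K where "K = (u - 1) * (u - \<rho>)"
  have K: "(E1 - E0) * K = 1 - \<rho> * E0" "(E2 - E0) * K = \<rho> - \<rho> * E0" "E2 * K = u - 1" "E1 * K = u - \<rho>"
    using inv unfolding K_def by algebra+
  have "(B - C) * (ux * ((E1 - E0) * K)) + (A + C) * (ux * ((E2 - E0) * K)) + A * (uy * (E2 * K)) + B * (uy * (E1 * K))
      = ((B - C) * (ux * (E1 - E0)) + (A + C) * (ux * (E2 - E0)) + A * (uy * E2) + B * (uy * E1)) * K"
    by (simp add: algebra_simps)
  then have K0: "(B - C) * (ux * (1 - \<rho> * E0)) + (A + C) * (ux * (\<rho> - \<rho> * E0))
      + A * (uy * (u - 1)) + B * (uy * (u - \<rho>)) = 0"
    unfolding main K by simp
  have "(A + B) * (u - \<rho> - (1 - \<rho>) * S) = (A + B) * (u - \<rho>) - (1 - \<rho>) * (S * (A + B))"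
    by (simp add: algebra_simps)
  also have "\<dots> = A * (u - 1) + B * (u - \<rho>)" unfolding ang by (simp add: algebra_simps)
  finally have P: "(A + B) * ((u - \<rho> - (1 - \<rho>) * S) * uy) = (A * (u - 1) + B * (u - \<rho>)) * uy"
    by (simp only: mult.assoc[symmetric])
  have "(A + B) * (\<rho> * (E0 - 1) - (1 - \<rho>) * T) = (A + B) * (\<rho> * (E0 - 1)) - (1 - \<rho>) * (T * (A + B))"
    by (simp add: algebra_simps)
  also have "\<dots> = - ((B - C) * (1 - \<rho> * E0) + (A + C) * (\<rho> - \<rho> * E0))" unfolding ang by (simp add: algebra_simps)
  finally have Q: "(A + B) * ((\<rho> * (E0 - 1) - (1 - \<rho>) * T) * ux)
     = - ((B - C) * (1 - \<rho> * E0) + (A + C) * (\<rho> - \<rho> * E0)) * ux"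
    by (simp only: mult.assoc[symmetric])
  have "(A + B) * ((u - \<rho> - (1 - \<rho>) * S) * uy) - (A + B) * ((\<rho> * (E0 - 1) - (1 - \<rho>) * T) * ux)
     = (B - C) * (ux * (1 - \<rho> * E0)) + (A + C) * (ux * (\<rho> - \<rho> * E0)) + A * (uy * (u - 1)) + B * (uy * (u - \<rho>))"
    unfolding P Q by (simp add: algebra_simps)
  then have "(A + B) * ((u - \<rho> - (1 - \<rho>) * S) * uy) = (A + B) * ((\<rho> * (E0 - 1) - (1 - \<rho>) * T) * ux)"
    unfolding K0 by simp
  then have "(u - \<rho> - (1 - \<rho>) * S) * uy = (\<rho> * (E0 - 1) - (1 - \<rho>) * T) * ux" using AB by simp
  then show ?thesis unfolding \<rho>_def S_def T_def E0_def ux_def uy_def by simp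
qed


section \<open>The analytic function g and its potential\<close>

text \<open>With \<open>P = u - r\<^sup>2 - (1 - r\<^sup>2) s\<close> and \<open>Q = r\<^sup>2 (1 / u - 1) - (1 - r\<^sup>2) t\<close> the differential of the
  function is \<open>(x - r\<^sup>2 y / u\<^sup>2) k + P x' k + Q y' k\<close>.  Since
  \<open>(P, Q)\<close> is a complex multiple of \<open>(ux, uy)\<close>, the gradient of \<open>u\<close>, the last two terms are
  \<open>P / ux \<cdot> k\<close>, so the differential is complex linear.\<close>

lemma legendre_field_differentiable:
  fixes x y h :: "complex \<Rightarrow> real" and ux uy u :: complex and r s t :: real
  assumes x: "(x has_derivative x') (at u)" and y: "(y has_derivative y') (at u)"
    and h: "(h has_derivative (\<lambda>k. s * x' k + t * y' k)) (at u)" and u: "u \<noteq> 0" and ux: "ux \<noteq> 0"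
    and inverse: "\<And>k. of_real (x' k) * ux + of_real (y' k) * uy = k"
    and burgers: "(u - of_real (r\<^sup>2) - of_real ((1 - r\<^sup>2) * s)) * uy
      = (of_real (r\<^sup>2) * (1 / u - 1) - of_real ((1 - r\<^sup>2) * t)) * ux"
  shows "(\<lambda>u. (u - of_real (r\<^sup>2)) * of_real (x u) + of_real (r\<^sup>2) * (1 / u - 1) * of_real (y u)
     - of_real (1 - r\<^sup>2) * of_real (h u)) field_differentiable (at u)"
proof -
  define \<rho> where "\<rho> = complex_of_real (r\<^sup>2)"
  define P Q where "P = u - \<rho> - (1 - \<rho>) * of_real s" and "Q = \<rho> * (1 / u - 1) - (1 - \<rho>) * of_real t"
  have PQ: "P * uy = Q * ux" using burgers unfolding P_def Q_def \<rho>_def by simp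
  have "((\<lambda>u. u - \<rho>) has_derivative (\<lambda>k. k - 0)) (at u)"
    by (intro has_derivative_diff has_derivative_ident has_derivative_const)
  moreover have "((\<lambda>u. \<rho> * (1 / u - 1)) has_field_derivative - \<rho> / u\<^sup>2) (at u)"
    using u by (auto intro!: derivative_eq_intros simp: power2_eq_square)
  then have "((\<lambda>u. \<rho> * (1 / u - 1)) has_derivative (\<lambda>k. - \<rho> / u\<^sup>2 * k)) (at u)"
    by (rule has_field_derivative_imp_has_derivative)
  ultimately have D: "((\<lambda>u. (u - \<rho>) * of_real (x u) + \<rho> * (1 / u - 1) * of_real (y u) - (1 - \<rho>) * of_real (h u))
     has_derivative (\<lambda>k. ((u - \<rho>) * of_real (x' k) + (k - 0) * of_real (x u)) +
       (\<rho> * (1 / u - 1) * of_real (y' k) + (- \<rho> / u\<^sup>2 * k) * of_real (y u)) -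
       (1 - \<rho>) * of_real (s * x' k + t * y' k))) (at u)"
    by (intro has_derivative_diff has_derivative_add has_derivative_mult has_derivative_mult_right
        has_derivative_of_real has_derivative_ident has_derivative_const x y h)
  have eq: "((u - \<rho>) * of_real (x' k) + (k - 0) * of_real (x u)) +
       (\<rho> * (1 / u - 1) * of_real (y' k) + (- \<rho> / u\<^sup>2 * k) * of_real (y u)) -
       (1 - \<rho>) * of_real (s * x' k + t * y' k) = k * (of_real (x u) - \<rho> / u\<^sup>2 * of_real (y u) + P / ux)" for k
  proof -
    have "P * of_real (x' k) + Q * of_real (y' k) = P / ux * (of_real (x' k) * ux + of_real (y' k) * uy)"
    proof -
      have "Q = P * uy / ux" using PQ ux by (simp add: eq_divide_eq)
      then show ?thesis using ux by (simp add: distrib_left)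
    qed
    then have "P * of_real (x' k) + Q * of_real (y' k) = P / ux * k" unfolding inverse .
    then show ?thesis unfolding P_def Q_def by (simp add: algebra_simps)
  qed
  have "((\<lambda>u. (u - \<rho>) * of_real (x u) + \<rho> * (1 / u - 1) * of_real (y u) - (1 - \<rho>) * of_real (h u))
     has_field_derivative (of_real (x u) - \<rho> / u\<^sup>2 * of_real (y u) + P / ux)) (at u)"
    using D unfolding eq by (rule has_derivative_imp_has_field_derivative) simp
  then show ?thesis unfolding \<rho>_def by (auto simp: field_differentiable_def)
qed

text \<open>The terms \<open>(\<pi> - arg (u - 1)) dx + (arg (u - r\<^sup>2) - arg u) dy - \<theta> dh\<close> cancel because
  \<open>dh = s dx + t dy\<close>.  The rest involves only the differentials of the three arguments, and partial
  fractions of \<open>g / ((1 - u) (u - r\<^sup>2))\<close> identify it.\<close>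

lemma potential_has_derivative:
  fixes x y h :: "complex \<Rightarrow> real" and u :: complex and r s t :: real
  assumes x: "(x has_derivative x') (at u)" and y: "(y has_derivative y') (at u)"
    and h: "(h has_derivative (\<lambda>k. s * x' k + t * y' k)) (at u)" and u: "Im u > 0"
    and s: "s * theta r u = pi - Arg (u - 1)" and t: "t * theta r u = Arg (u - r\<^sup>2) - Arg u"
  defines "g \<equiv> (u - of_real (r\<^sup>2)) * of_real (x u) + of_real (r\<^sup>2) * (1 / u - 1) * of_real (y u)
     - of_real (1 - r\<^sup>2) * of_real (h u)"
  shows "((\<lambda>u. r\<^sup>2 * ((pi - Arg (u - 1)) * x u + (Arg (u - r\<^sup>2) - Arg u) * y u - theta r u * h u))
    has_derivative (\<lambda>k. Im (of_real (r\<^sup>2) * g / ((1 - u) * (u - of_real (r\<^sup>2))) * k))) (at u)"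
proof -
  define \<rho> where "\<rho> = complex_of_real (r\<^sup>2)"
  define E1 E2 E0 where "E1 = 1 / (u - 1)" and "E2 = 1 / (u - \<rho>)" and "E0 = 1 / u"
  have nz: "u \<noteq> 0" "u - 1 \<noteq> 0" "u - \<rho> \<noteq> 0" using u by (auto simp: complex_eq_iff \<rho>_def)
  note A = angle_has_derivative[OF has_derivative_ident u]
  have d1: "((\<lambda>u. Arg (u - 1)) has_derivative (\<lambda>k. Im (k * E1))) (at u)"
    using A[of 1] by (simp add: E1_def)
  have d2: "((\<lambda>u. Arg (u - r\<^sup>2)) has_derivative (\<lambda>k. Im (k * E2))) (at u)"
    using A[of "r\<^sup>2"] unfolding E2_def \<rho>_def by simp
  have d0: "((\<lambda>u. Arg u) has_derivative (\<lambda>k. Im (k * E0))) (at u)"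
    using A[of 0] by (simp add: E0_def)
  have "((\<lambda>u. r\<^sup>2 * ((pi - Arg (u - 1)) * x u + (Arg (u - r\<^sup>2) - Arg u) * y u - theta r u * h u))
    has_derivative (\<lambda>k. r\<^sup>2 * (((pi - Arg (u - 1)) * x' k + (0 - Im (k * E1)) * x u)
      + ((Arg (u - r\<^sup>2) - Arg u) * y' k + (Im (k * E2) - Im (k * E0)) * y u)
      - (theta r u * (s * x' k + t * y' k) + (0 - Im (k * E1) + Im (k * E2)) * h u)))) (at u)"
    unfolding theta_def
    by (intro has_derivative_mult_right has_derivative_diff has_derivative_add has_derivative_mult
        has_derivative_const d1 d2 d0 x y h)
  moreover have "r\<^sup>2 * (((pi - Arg (u - 1)) * x' k + (0 - Im (k * E1)) * x u)
      + ((Arg (u - r\<^sup>2) - Arg u) * y' k + (Im (k * E2) - Im (k * E0)) * y u)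
      - (theta r u * (s * x' k + t * y' k) + (0 - Im (k * E1) + Im (k * E2)) * h u))
     = Im (of_real (r\<^sup>2) * g / ((1 - u) * (u - of_real (r\<^sup>2))) * k)" for k
  proof -
    have g_over: "g / ((1 - u) * (u - \<rho>)) = - E1 * of_real (x u) + (E2 - E0) * of_real (y u) - (E2 - E1) * of_real (h u)"
    proof -
      have inv: "E1 * (u - 1) = 1" "E2 * (u - \<rho>) = 1" "E0 * u = 1" using nz by (simp_all add: E1_def E2_def E0_def)
      have geq: "g = (u - \<rho>) * of_real (x u) + \<rho> * (E0 - 1) * of_real (y u) - (1 - \<rho>) * of_real (h u)"
        unfolding g_def \<rho>_def E0_def by simp
      have "g = (- E1 * of_real (x u) + (E2 - E0) * of_real (y u) - (E2 - E1) * of_real (h u)) * ((1 - u) * (u - \<rho>))"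
      proof -
        define K where "K = (1 - u) * (u - \<rho>)"
        have K: "E1 * K = \<rho> - u" "(E2 - E0) * K = \<rho> * (E0 - 1)" "(E2 - E1) * K = 1 - \<rho>"
          using inv unfolding K_def by algebra+
        have "(- E1 * of_real (x u) + (E2 - E0) * of_real (y u) - (E2 - E1) * of_real (h u)) * K
          = - (E1 * K) * of_real (x u) + ((E2 - E0) * K) * of_real (y u) - ((E2 - E1) * K) * of_real (h u)"
          by (simp add: algebra_simps)
        also have "\<dots> = (u - \<rho>) * of_real (x u) + \<rho> * (E0 - 1) * of_real (y u) - (1 - \<rho>) * of_real (h u)"
          unfolding K by simp
        finally show ?thesis unfolding K_def geq ..
      qed
      moreover have "(1 - u) * (u - \<rho>) \<noteq> 0" using nz by auto
      ultimately show ?thesis by (simp add: eq_divide_eq)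
    qed
    have "of_real (r\<^sup>2) * g / ((1 - u) * (u - \<rho>)) * k = of_real (r\<^sup>2) * (g / ((1 - u) * (u - \<rho>))) * k"
      by simp
    also have "\<dots> = of_real (r\<^sup>2) * (of_real (- x u) * (k * E1) + of_real (y u) * (k * E2 - k * E0)
        - of_real (h u) * (k * E2 - k * E1))"
      unfolding g_over by (simp add: algebra_simps del: of_real_power)
    finally have Im_eq: "Im (of_real (r\<^sup>2) * g / ((1 - u) * (u - \<rho>)) * k)
       = r\<^sup>2 * (- x u * Im (k * E1) + y u * (Im (k * E2) - Im (k * E0)) - h u * (Im (k * E2) - Im (k * E1)))"
      by (simp only: Im_of_real_times plus_complex.sel minus_complex.sel)
    have "theta r u * (s * x' k + t * y' k) = (pi - Arg (u - 1)) * x' k + (Arg (u - r\<^sup>2) - Arg u) * y' k"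
      unfolding s[symmetric] t[symmetric] by (simp add: algebra_simps)
    then show ?thesis unfolding Im_eq[unfolded \<rho>_def] by (simp only:) (simp add: algebra_simps)
  qed
  ultimately show ?thesis by simp
qed

text \<open>Multiplied by \<open>\<pi> (1 - r\<^sup>2)\<close>, the real number in the second factor equals
  \<^const>\<open>weighted_angle_sum\<close> times \<open>x\<close>: substituting \<open>Re g\<close> and \<open>k\<close> makes the coefficients of \<open>y\<close> and
  \<open>h\<close> cancel.  The relation for \<open>k\<close> is \<open>Im g / Im u\<close> written out.\<close>

lemma x_from_potential:
  fixes r x y h a b c k :: real and u g :: complex
  assumes r: "0 < r" "r < 1" and u: "Im u > 0"
  defines "a \<equiv> pi - Arg (u - 1)" and "b \<equiv> Arg (u - r\<^sup>2)" and "c \<equiv> Arg u"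
  assumes g: "g = (u - r\<^sup>2) * x + r\<^sup>2 * (1 / u - 1) * y - (1 - r\<^sup>2) * h"
    and k: "k = Im g / Im u"
  shows "complex_of_real x = - 1 / (r\<^sup>2 * fun_A (w_of r u) - (cmod u)\<^sup>2 * fun_A (z_of r u)) *
     complex_of_real (r\<^sup>2 * (a * x + (b - c) * y - theta r u * h) / pi
       + Re (- (r\<^sup>2 * g * theta r u) / (pi * (1 - r\<^sup>2)) + fun_A (z_of r u) * (cmod u)\<^sup>2 * k))"
    "k = x - r\<^sup>2 * y / (cmod u)\<^sup>2"
proof -
  define p q where "p = Re u" and "q = Im u"
  have u_eq: "u = Complex p q" and q: "q > 0" using u by (auto simp: p_def q_def)
  define N where "N = p\<^sup>2 + q\<^sup>2"
  have N: "(cmod u)\<^sup>2 = N" "N > 0" "complex_of_real N = u * cnj u"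
  proof -
    show *: "(cmod u)\<^sup>2 = N" by (simp add: N_def cmod_power2 p_def q_def)
    show "N > 0" using q by (simp add: N_def add_nonneg_pos)
    show "complex_of_real N = u * cnj u" unfolding *[symmetric] by (rule complex_norm_square)
  qed
  have nz: "u \<noteq> 0" using u by auto
  have r2: "r\<^sup>2 < 1" using r by (simp add: abs_square_less_1)
  have inv: "1 / u = cnj u / of_real N" using N nz by (simp add: field_simps)
  have Reg: "Re g = (p - r\<^sup>2) * x + r\<^sup>2 * (p / N - 1) * y - (1 - r\<^sup>2) * h"
    and Img: "Im g = q * x - r\<^sup>2 * (q / N) * y"
    unfolding g inv by (simp_all add: u_eq del: of_real_power)
  show kx: "k = x - r\<^sup>2 * y / (cmod u)\<^sup>2"
    unfolding k Img N using q N by (simp add: u_eq field_simps)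
  have "fun_A (z_of r u) * (cmod u)\<^sup>2 = u * ((cnj u - r\<^sup>2) * (b - c) - r\<^sup>2 * (1 - cnj u) * (a + c)) / of_real (pi * (1 - r\<^sup>2))"
    unfolding fun_A_w_z[OF r u] N(1) N(3) using nz by (simp add: a_def b_def c_def)
  then have "Re (fun_A (z_of r u) * (cmod u)\<^sup>2) =
     ((N - r\<^sup>2 * p) * (b - c) - r\<^sup>2 * (p - N) * (a + c)) / (pi * (1 - r\<^sup>2))"
    by (simp only: Re_divide_of_real) (simp add: u_eq N_def power2_eq_square algebra_simps del: of_real_power)
  then have Az: "Re (fun_A (z_of r u) * (cmod u)\<^sup>2 * k) =
     ((N - r\<^sup>2 * p) * (b - c) - r\<^sup>2 * (p - N) * (a + c)) / (pi * (1 - r\<^sup>2)) * k" by simp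
  have "- (r\<^sup>2 * g * theta r u) / (pi * (1 - r\<^sup>2)) = of_real (- (r\<^sup>2 * theta r u) / (pi * (1 - r\<^sup>2))) * g"
    by simp
  then have Rg: "Re (- (r\<^sup>2 * g * theta r u) / (pi * (1 - r\<^sup>2))) = - (r\<^sup>2 * theta r u) / (pi * (1 - r\<^sup>2)) * Re g"
    by simp
  have G: "weighted_angle_sum r u = r\<^sup>2 * ((p - 1)\<^sup>2 + q\<^sup>2) * a + ((p - r\<^sup>2)\<^sup>2 + q\<^sup>2) * b - (1 - r\<^sup>2) * N * c"
    unfolding weighted_angle_sum_def N a_def b_def c_def
    by (simp add: cmod_power2 u_eq del: of_real_power)
  have th: "theta r u = a + b" unfolding theta_def a_def b_def by simp
  define \<kappa> where "\<kappa> = pi * (1 - r\<^sup>2)"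
  have \<kappa>: "\<kappa> > 0" using r2 by (simp add: \<kappa>_def)
  have "\<kappa> * (r\<^sup>2 * (a * x + (b - c) * y - theta r u * h) / pi
       + Re (- (r\<^sup>2 * g * theta r u) / (pi * (1 - r\<^sup>2)) + fun_A (z_of r u) * (cmod u)\<^sup>2 * k))
     = (1 - r\<^sup>2) * r\<^sup>2 * (a * x + (b - c) * y - theta r u * h) - r\<^sup>2 * theta r u * Re g
       + ((N - r\<^sup>2 * p) * (b - c) - r\<^sup>2 * (p - N) * (a + c)) * k"
  proof -
    have *: "\<kappa> * (A / pi + (- B / \<kappa> * G + C / \<kappa> * k)) = (1 - r\<^sup>2) * A - B * G + C * k" for A B C G :: real
    proof -
      have "\<kappa> * (A / pi) = (1 - r\<^sup>2) * A" by (simp add: \<kappa>_def)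
      moreover have "\<kappa> * (- B / \<kappa> * G) = - B * G" "\<kappa> * (C / \<kappa> * k) = C * k" using \<kappa> by simp_all
      ultimately show ?thesis unfolding distrib_left by simp
    qed
    show ?thesis unfolding plus_complex.sel Az Rg unfolding \<kappa>_def[symmetric]
      using *[of "r\<^sup>2 * (a * x + (b - c) * y - theta r u * h)" "r\<^sup>2 * theta r u" "Re g"
          "(N - r\<^sup>2 * p) * (b - c) - r\<^sup>2 * (p - N) * (a + c)"] by (simp only: mult.assoc)
  qed
  also have "\<dots> = weighted_angle_sum r u * x"
    unfolding G th Reg kx N(1) using N(2)
    by (simp add: field_simps) (simp add: N_def power2_eq_square power4_eq_xxxx algebra_simps)
  finally have main: "\<kappa> * (r\<^sup>2 * (a * x + (b - c) * y - theta r u * h) / pi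
       + Re (- (r\<^sup>2 * g * theta r u) / (pi * (1 - r\<^sup>2)) + fun_A (z_of r u) * (cmod u)\<^sup>2 * k))
     = weighted_angle_sum r u * x" .
  have nzG: "weighted_angle_sum r u > 0" by (rule weighted_angle_sum_pos[OF r u])
  define S where "S = r\<^sup>2 * (a * x + (b - c) * y - theta r u * h) / pi
       + Re (- (r\<^sup>2 * g * theta r u) / (pi * (1 - r\<^sup>2)) + fun_A (z_of r u) * (cmod u)\<^sup>2 * k)"
  have "x = - 1 / (- weighted_angle_sum r u / \<kappa>) * S"
    using main[folded S_def] nzG \<kappa> by (simp add: field_simps)
  then have "complex_of_real x = - 1 / of_real (- weighted_angle_sum r u / \<kappa>) * of_real S"
    by (metis of_real_1 of_real_divide of_real_minus of_real_mult)
  then show "complex_of_real x = - 1 / (r\<^sup>2 * fun_A (w_of r u) - (cmod u)\<^sup>2 * fun_A (z_of r u)) *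
     complex_of_real (r\<^sup>2 * (a * x + (b - c) * y - theta r u * h) / pi
       + Re (- (r\<^sup>2 * g * theta r u) / (pi * (1 - r\<^sup>2)) + fun_A (z_of r u) * (cmod u)\<^sup>2 * k))"
    unfolding fun_A_difference[OF r u] S_def \<kappa>_def .
qed

lemma C1_diffeomorphism_derivatives:
  assumes diff: "C1_diffeomorphism V W f h" and w: "w \<in> W"
  obtains M L where "(f has_derivative M) (at (h w))" "(h has_derivative L) (at w)"
    "\<And>k. M (L k) = k" "\<And>k. L (M k) = k"
proof -
  have V: "open V" "open W" "h w \<in> V" and inv: "\<And>v. v \<in> V \<Longrightarrow> h (f v) = v" "\<And>w. w \<in> W \<Longrightarrow> f (h w) = w"
    using diff w unfolding C1_diffeomorphism_def homeomorphism_def by auto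
  obtain M where M: "(f has_derivative M) (at (h w))"
    using diff V unfolding C1_diffeomorphism_def C1_on_def by blast
  obtain L where L: "(h has_derivative L) (at w)"
    using diff w unfolding C1_diffeomorphism_def C1_on_def by blast
  have "((\<lambda>w. w) has_derivative (\<lambda>k. M (L k))) (at w)"
    using has_derivative_compose[OF L M] V(2) w by (rule has_derivative_transform_within_open) (simp add: inv)
  then have "(\<lambda>k. M (L k)) = (\<lambda>k. k)" using has_derivative_ident by (rule has_derivative_unique)
  then have "M (L k) = k" for k by (rule fun_cong)
  moreover have "((\<lambda>v. v) has_derivative (\<lambda>k. L (M k))) (at (h w))"
  proof (rule has_derivative_transform_within_open[OF _ V(1,3)])
    have "(h has_derivative L) (at (f (h w)))" using L inv(2)[OF w] by simp
    with M show "((\<lambda>v. h (f v)) has_derivative (\<lambda>k. L (M k))) (at (h w))"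
      by (rule has_derivative_compose)
  qed (rule inv(1))
  then have "(\<lambda>k. L (M k)) = (\<lambda>k. k)" using has_derivative_ident by (rule has_derivative_unique)
  then have "L (M k) = k" for k by (rule fun_cong)
  ultimately show thesis using M L that by blast
qed


section \<open>Limit shapes in the coordinate u\<close>

theorem theorem7p5:
  fixes r :: real
    and U V :: "(real \<times> real) set"
    and W :: "complex set"
    and H :: "real \<times> real \<Rightarrow> real"
    and p\<^sub>0 :: "real \<times> real"
    and x y :: "complex \<Rightarrow> real"
  assumes r: "0 < r" "r < 1"
    and U: "open U"
    and H_C2: "C2_on U H"
    and slope: "\<And>p. p \<in> U \<Longrightarrow> grad H p \<in> interior_Nstar r"
    and EL: "Euler_Lagrange r U H"
    and V: "p\<^sub>0 \<in> V" "V \<subseteq> U"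
    and coord: "C1_diffeomorphism V W (\<lambda>p. u_point r (grad H p)) (\<lambda>u. (x u, y u))"
  shows "\<exists>(W' :: complex set) (g :: complex \<Rightarrow> complex) (F :: complex \<Rightarrow> complex) (k :: complex \<Rightarrow> real).
      open W' \<and> u_point r (grad H p\<^sub>0) \<in> W' \<and> W' \<subseteq> W \<and>
      g analytic_on W' \<and>
      (\<forall>u\<in>W'. (F has_field_derivative r\<^sup>2 * g u / ((1 - u) * (u - r\<^sup>2))) (at u)) \<and>
      (\<forall>u\<in>W'. k u = Im (g u) / Im u \<and>
               k u = Im (deriv F u * (1 - u) * (u - r\<^sup>2)) / (r\<^sup>2 * Im u)) \<and>
      (\<forall>u\<in>W'. let R = cmod u; w = w_of r u; z = z_of r u in
         complex_of_real (x u) =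
           - 1 / (r\<^sup>2 * fun_A w - R\<^sup>2 * fun_A z) *
           complex_of_real (Im (1 / pi * F u) +
             Re (- (deriv F u * (1 - u) * (u - r\<^sup>2) * theta r u) / (pi * (1 - r\<^sup>2))
                 + fun_A z * R\<^sup>2 * k u)) \<and>
         complex_of_real (y u) = u * cnj u / r\<^sup>2 * (x u - k u) \<and>
         complex_of_real (H (x u, y u)) =
           1 / (1 - r\<^sup>2) *
           (- cnj (g u) + (cnj u - r\<^sup>2) * x u + r\<^sup>2 * (inverse (cnj u) - 1) * y u))"
proof -
  define v where "v = (\<lambda>p. u_point r (grad H p))"
  define h where "h = (\<lambda>u. H (x u, y u))"
  define s t where "s = (\<lambda>u. fst (grad H (x u, y u)))" and "t = (\<lambda>u. snd (grad H (x u, y u)))"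
  define g where "g = (\<lambda>u. (u - of_real (r\<^sup>2)) * of_real (x u) + of_real (r\<^sup>2) * (1 / u - 1) * of_real (y u)
     - of_real (1 - r\<^sup>2) * of_real (h u))"
  define \<Phi> where "\<Phi> = (\<lambda>u. r\<^sup>2 * ((pi - Arg (u - 1)) * x u + (Arg (u - r\<^sup>2) - Arg u) * y u - theta r u * h u))"
  define f where "f = (\<lambda>u. of_real (r\<^sup>2) * g u / ((1 - u) * (u - of_real (r\<^sup>2))))"
  note angle_eqs = u_point_properties[OF r slope]
  have oW: "open W" and inU: "\<And>u. u \<in> W \<Longrightarrow> (x u, y u) \<in> U" and vW: "\<And>u. u \<in> W \<Longrightarrow> v (x u, y u) = u"
    and u0: "v p\<^sub>0 \<in> W"
    using coord V unfolding C1_diffeomorphism_def homeomorphism_def v_def by auto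
  have angles: "Im u > 0" "s u * theta r u = pi - Arg (u - 1)" "t u * theta r u = Arg (u - r\<^sup>2) - Arg u"
    if "u \<in> W" for u
    using angle_eqs[OF inU[OF that]] vW[OF that] unfolding v_def s_def t_def by auto

  have charts: "g field_differentiable (at u) \<and> (\<Phi> has_derivative (\<lambda>k. Im (f u * k))) (at u)" if u: "u \<in> W" for u
  proof -
    obtain M L where M: "(v has_derivative M) (at (x u, y u))" and L: "((\<lambda>u. (x u, y u)) has_derivative L) (at u)"
      and M_L: "\<And>k. M (L k) = k" and L_M: "\<And>k. L (M k) = k"
      using C1_diffeomorphism_derivatives[OF coord u] unfolding v_def by blast
    interpret M: bounded_linear M using M by (rule has_derivative_bounded_linear)
    interpret L: bounded_linear L using L by (rule has_derivative_bounded_linear)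
    have dx: "(x has_derivative (\<lambda>k. fst (L k))) (at u)" and dy: "(y has_derivative (\<lambda>k. snd (L k))) (at u)"
      using has_derivative_fst[OF L] has_derivative_snd[OF L] by simp_all
    have dh: "(h has_derivative (\<lambda>k. s u * fst (L k) + t u * snd (L k))) (at u)"
      using has_derivative_compose[OF L C2_gradient(1)[OF U H_C2 inU[OF u]]]
      unfolding h_def s_def t_def .
    have inverse: "of_real (fst (L k)) * M (1, 0) + of_real (snd (L k)) * M (0, 1) = k" for k
    proof -
      have "L k = fst (L k) *\<^sub>R (1, 0) + snd (L k) *\<^sub>R (0, 1)" by (simp add: prod_eq_iff)
      then have "M (L k) = M (fst (L k) *\<^sub>R (1, 0) + snd (L k) *\<^sub>R (0, 1))" by (rule arg_cong)
      then show ?thesis unfolding M_L M.add M.scaleR scaleR_conv_of_real by (rule sym)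
    qed
    have ux: "M (1, 0) \<noteq> 0"
    proof
      assume "M (1, 0) = 0"
      then have "L (M (1, 0)) = 0" using L.zero by simp
      then show False unfolding L_M by (simp add: zero_prod_def)
    qed
    have burgers: "(u - of_real (r\<^sup>2) - of_real ((1 - r\<^sup>2) * s u)) * M (0, 1)
        = (of_real (r\<^sup>2) * (1 / u - 1) - of_real ((1 - r\<^sup>2) * t u)) * M (1, 0)"
      using complex_burgers[OF r U H_C2 slope EL inU[OF u] M[unfolded v_def]] vW[OF u]
      unfolding v_def s_def t_def by simp
    have "u \<noteq> 0" using angles(1)[OF u] by auto
    from legendre_field_differentiable[OF dx dy dh this ux inverse burgers]
    have "g field_differentiable (at u)" unfolding g_def .
    moreover have "(\<Phi> has_derivative (\<lambda>k. Im (f u * k))) (at u)"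
      using potential_has_derivative[OF dx dy dh angles[OF u]] unfolding \<Phi>_def f_def g_def .
    ultimately show ?thesis ..
  qed

  (* On a disc inside W the form f du has a primitive. *)
  obtain e where e: "e > 0" "ball (v p\<^sub>0) e \<subseteq> W" using openE[OF oW u0] by blast
  define B where "B = ball (v p\<^sub>0) e"
  have B: "open B" "convex B" "B \<subseteq> W" "v p\<^sub>0 \<in> B" using e by (auto simp: B_def)
  have g_hol: "g holomorphic_on B"
    unfolding holomorphic_on_def using charts B(3) by (blast intro: field_differentiable_at_within)
  have nz: "1 - u \<noteq> 0" "u - of_real (r\<^sup>2) \<noteq> 0" if "u \<in> W" for u
    using angles(1)[OF that] by (auto simp: complex_eq_iff)
  have f_hol: "f holomorphic_on B"
    unfolding f_def using nz B(3) by (intro holomorphic_intros g_hol) auto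
  obtain F0 where F0_B: "\<And>u. u \<in> B \<Longrightarrow> (F0 has_field_derivative f u) (at u within B)"
    using holomorphic_convex_primitive'[OF B(2,1) f_hol] by blast
  have F0: "(F0 has_field_derivative f u) (at u)" if "u \<in> B" for u
    using F0_B[OF that] unfolding at_within_open[OF that B(1)] .
  have "\<exists>c. \<forall>u\<in>B. \<Phi> u - Im (F0 u) = c"
  proof (rule has_derivative_zero_constant[OF B(2)])
    fix u assume u: "u \<in> B"
    have "((\<lambda>u. \<Phi> u - Im (F0 u)) has_derivative (\<lambda>k. Im (f u * k) - Im (f u * k))) (at u)"
      using charts[of u] B(3) u
      by (intro has_derivative_diff has_derivative_Im has_field_derivative_imp_has_derivative F0) auto
    then show "((\<lambda>u. \<Phi> u - Im (F0 u)) has_derivative (\<lambda>h. 0)) (at u within B)"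
      by (simp add: has_derivative_at_withinI)
  qed
  then obtain c where c: "\<And>u. u \<in> B \<Longrightarrow> \<Phi> u - Im (F0 u) = c" by blast
  (* The imaginary constant of integration is chosen so that Im F is the potential. *)
  define F where "F = (\<lambda>u. F0 u + \<i> * of_real c)"
  have F: "(F has_field_derivative f u) (at u)" if "u \<in> B" for u
    unfolding F_def using F0[OF that] by (auto intro!: derivative_eq_intros)
  have ImF: "Im (F u) = \<Phi> u" if "u \<in> B" for u unfolding F_def using c[OF that] by simp
  have dF: "deriv F u * (1 - u) * (u - r\<^sup>2) = r\<^sup>2 * g u" if "u \<in> B" for u :: complex
    using DERIV_imp_deriv[OF F[OF that]] nz[of u] that B(3) unfolding f_def by auto
  define k where "k u = Im (g u) / Im u" for u

  show ?thesis
  proof (rule exI[of _ B], rule exI[of _ g], rule exI[of _ F], rule exI[of _ k], intro conjI ballI)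
    show "u_point r (grad H p\<^sub>0) \<in> B" using B(4) by (simp add: v_def)
    show "g analytic_on B" using g_hol B(1) by (simp add: analytic_on_open)
  next
    fix u assume u: "u \<in> B"
    then have uW: "u \<in> W" and Im_u: "Im u > 0" using B(3) angles(1) by auto
    show "(F has_field_derivative r\<^sup>2 * g u / ((1 - u) * (u - r\<^sup>2))) (at u)"
      using F[OF u] by (simp add: f_def)
    show "k u = Im (g u) / Im u" by (simp add: k_def)
    show "k u = Im (deriv F u * (1 - u) * (u - r\<^sup>2)) / (r\<^sup>2 * Im u)"
    proof -
      have "Im (deriv F u * (1 - u) * (u - r\<^sup>2)) = r\<^sup>2 * Im (g u)" unfolding dF[OF u] by (rule Im_of_real_times)
      then show ?thesis using r by (simp add: k_def)
    qed
    show "let R = cmod u; w = w_of r u; z = z_of r u in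
         complex_of_real (x u) =
           - 1 / (r\<^sup>2 * fun_A w - R\<^sup>2 * fun_A z) *
           complex_of_real (Im (1 / pi * F u) +
             Re (- (deriv F u * (1 - u) * (u - r\<^sup>2) * theta r u) / (pi * (1 - r\<^sup>2))
                 + fun_A z * R\<^sup>2 * k u)) \<and>
         complex_of_real (y u) = u * cnj u / r\<^sup>2 * (x u - k u) \<and>
         complex_of_real (H (x u, y u)) =
           1 / (1 - r\<^sup>2) *
           (- cnj (g u) + (cnj u - r\<^sup>2) * x u + r\<^sup>2 * (inverse (cnj u) - 1) * y u)"
      unfolding Let_def
    proof (intro conjI)
      have g_eq: "g u = (u - r\<^sup>2) * x u + r\<^sup>2 * (1 / u - 1) * y u - (1 - r\<^sup>2) * h u" by (simp add: g_def)
      note main = x_from_potential[OF r Im_u g_eq, of "k u", unfolded k_def, OF refl, folded k_def]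
      have "Im (1 / pi * F u) = r\<^sup>2 * ((pi - Arg (u - 1)) * x u + (Arg (u - r\<^sup>2) - Arg u) * y u - theta r u * h u) / pi"
        using ImF[OF u] Im_of_real_times[of "1 / pi" "F u"] unfolding \<Phi>_def by simp
      with main(1) show "complex_of_real (x u) =
           - 1 / (r\<^sup>2 * fun_A (w_of r u) - (cmod u)\<^sup>2 * fun_A (z_of r u)) *
           complex_of_real (Im (1 / pi * F u) +
             Re (- (deriv F u * (1 - u) * (u - r\<^sup>2) * theta r u) / (pi * (1 - r\<^sup>2))
                 + fun_A (z_of r u) * (cmod u)\<^sup>2 * k u))"
        unfolding dF[OF u] by (simp only:)
      have Rpos: "(cmod u)\<^sup>2 > 0" using Im_u by auto
      have "y u = (cmod u)\<^sup>2 / r\<^sup>2 * (x u - k u)"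
        unfolding main(2) using r Rpos by (simp add: field_simps)
      then have "complex_of_real (y u) = of_real ((cmod u)\<^sup>2) / of_real (r\<^sup>2) * (of_real (x u) - of_real (k u))"
        by (metis of_real_diff of_real_divide of_real_mult)
      then show "complex_of_real (y u) = u * cnj u / r\<^sup>2 * (x u - k u)"
        unfolding complex_norm_square by simp
      have "1 - r\<^sup>2 \<noteq> 0" using r by (simp add: power2_eq_1_iff)
      then have d: "complex_of_real (1 - r\<^sup>2) \<noteq> 0" unfolding of_real_eq_0_iff .
      have "complex_of_real (1 - r\<^sup>2) * of_real (h u) = - cnj (g u) + (cnj u - r\<^sup>2) * x u + r\<^sup>2 * (inverse (cnj u) - 1) * y u"
        by (simp add: g_def divide_inverse)
      then have "of_real (h u) = 1 / complex_of_real (1 - r\<^sup>2) *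
          (- cnj (g u) + (cnj u - r\<^sup>2) * x u + r\<^sup>2 * (inverse (cnj u) - 1) * y u)"
        using d by (metis divide_divide_eq_left mult.left_neutral nonzero_mult_div_cancel_left times_divide_eq_left)
      then show "complex_of_real (H (x u, y u)) = 1 / (1 - r\<^sup>2) *
           (- cnj (g u) + (cnj u - r\<^sup>2) * x u + r\<^sup>2 * (inverse (cnj u) - 1) * y u)"
        by (simp add: h_def)
    qed
  qed (use B in auto)
qed

end
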